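(* Let $R=(a_h)_{h\ge1}$ be an $\infty$-folding sequence and let $S=(s_h)_{h\in\mathbb{Z}}$ be defined by $s_h=a_h$ and $s_{-h}=-a_h$ for $h\ge1$, and $s_0=\varepsilon$ for some fixed $\varepsilon\in\{+1,-1\}$ (i.e. $S=(\overline{R},\varepsilon,R)$). Let $C$ be a complete curve with associated sequence $S$, and let $\mathcal{C}$ be a covering of $\mathbb{R}^2$ by complete folding curves which contains $C$ and satisfies the local isomorphism property. (1) If the set $\{n\in\mathbb{N}: a_{2^n}=(-1)^n\}$ is finite or cofinite, then $\mathcal{C}$ consists of exactly $2$ curves whose associated sequences are $S$ (up to a shift of indices) and $4$ other curves. (2) Otherwise, $\mathcal{C}$ consists of exactly $2$ curves, both with associated sequence $S$ (up to a shift of indices).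
   Context: All sequences take values in $\{+1,-1\}$. For $S=(a_1,\dots,a_n)$ write $\overline{S}=(-a_n,\dots,-a_1)$. The $n$-folding sequences are defined recursively: the only $0$-folding sequence is the empty sequence, and the $(n+1)$-folding sequences are exactly $(\overline{S},+1,S)$ and $(\overline{S},-1,S)$ with $S$ an $n$-folding sequence. An $\infty$-folding sequence is a sequence $(a_k)_{k\ge1}$ such that $(a_1,\dots,a_{2^n-1})$ is an $n$-folding sequence for every $n\ge1$. A subword of a sequence $(b_k)$ is a block $(b_{h+1},\dots,b_{h+m})$. A complete folding sequence is a sequence $(a_k)_{k\in\mathbb{Z}}$ each finite subword of which is a subword of some $n$-folding sequence. A segment is an oriented unit edge of $\mathbb{Z}^2$. A complete curve is a sequence $(C_i)_{i\in\mathbb{Z}}$ of segments such that the terminal point of $C_i$ is the initial point of $C_{i+1}$, consecutive supports are perpendicular, and all supports are pairwise distinct (curves differing by an index shift are identified). Its associated sequence is $(\eta_i)_{i\in\mathbb{Z}}$ with $\eta_i=+1$ (resp. $-1$) if one turns left (resp. right) from $C_i$ to $C_{i+1}$. A complete folding curve is a complete curve whose associated sequence is a complete folding sequence. A covering of $\mathbb{R}^2$ by complete folding curves is a set $\mathcal{C}$ of complete folding curves such that every unit edge of $\mathbb{Z}^2$ is the support of exactly one segment of exactly one curve of $\mathcal{C}$. A decorated segment of $\mathcal{C}$ is a segment of a curve of $\mathcal{C}$ together with, at each endpoint, the support of the segment of the same curve which precedes/follows it there. $\mathcal{C}$ satisfies the local isomorphism property if for every finite set $F$ of decorated segments of $\mathcal{C}$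 there is $r>0$ such that every disk of radius $r$ contains a translate $v+F$ ($v\in\mathbb{Z}^2$) which is a set of decorated segments of $\mathcal{C}$. *)

theory Defs
  imports "HOL-Analysis.Analysis" "HOL-Library.Sublist"
begin

definition bar :: "int list \<Rightarrow> int list" where
  "bar S = map uminus (rev S)"

inductive folding :: "nat \<Rightarrow> int list \<Rightarrow> bool" where
  folding_0: "folding 0 []"
| folding_Suc: "folding n S \<Longrightarrow> e \<in> {1, -1} \<Longrightarrow> folding (Suc n) (bar S @ [e] @ S)"

(* Indexed from 1; the value a 0 is irrelevant. *)
definition infinite_folding_seq :: "(nat \<Rightarrow> int) \<Rightarrow> bool" where
  "infinite_folding_seq a \<longleftrightarrow> (\<forall>n\<ge>1. folding n (map a [1..<2 ^ n]))"

definition complete_folding_seq :: "(int \<Rightarrow> int) \<Rightarrow> bool" where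
  "complete_folding_seq s \<longleftrightarrow>
     (\<forall>(h::int) (m::nat). \<exists>n T. folding n T \<and> sublist (map s [h + 1..h + int m]) T)"

definition two_sided :: "(nat \<Rightarrow> int) \<Rightarrow> int \<Rightarrow> int \<Rightarrow> int" where
  "two_sided a e h = (if h > 0 then a (nat h) else if h = 0 then e else - a (nat (- h)))"

type_synonym point = "int \<times> int"
type_synonym segment = "point \<times> point" \<comment> \<open>initial point, terminal point\<close>
type_synonym edge = "point set" \<comment> \<open>the set of the two endpoints\<close>

definition dir :: "segment \<Rightarrow> point" where
  "dir c = snd c - fst c"

definition is_segment :: "segment \<Rightarrow> bool" where
  "is_segment c \<longleftrightarrow> \<bar>fst (dir c)\<bar> + \<bar>snd (dir c)\<bar> = 1"

definition support :: "segment \<Rightarrow> edge" where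
  "support c = {fst c, snd c}"

definition unit_edges :: "edge set" where
  "unit_edges = support ` {c. is_segment c}"

definition perp :: "point \<Rightarrow> point \<Rightarrow> bool" where
  "perp u v \<longleftrightarrow> fst u * fst v + snd u * snd v = 0"

definition cross :: "point \<Rightarrow> point \<Rightarrow> int" where
  "cross u v = fst u * snd v - snd u * fst v"

definition complete_curve :: "(int \<Rightarrow> segment) \<Rightarrow> bool" where
  "complete_curve C \<longleftrightarrow>
     (\<forall>i. is_segment (C i)) \<and>
     (\<forall>i. snd (C i) = fst (C (i + 1))) \<and>
     (\<forall>i. perp (dir (C i)) (dir (C (i + 1)))) \<and>
     inj (\<lambda>i. support (C i))"

definition turns :: "(int \<Rightarrow> segment) \<Rightarrow> int \<Rightarrow> int" where
  "turns C i = (if cross (dir (C i)) (dir (C (i + 1))) > 0 then 1 else -1)"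

definition shift_rel :: "((int \<Rightarrow> segment) \<times> (int \<Rightarrow> segment)) set" where
  "shift_rel = {(C, D). \<exists>k. D = (\<lambda>i. C (i + k))}"

(* Curves are identified up to a shift of indices, so a member of a covering is a
   shift class; the parametrized curves in the class are its elements. *)
type_synonym curve = "(int \<Rightarrow> segment) set"

definition curve_of :: "(int \<Rightarrow> segment) \<Rightarrow> curve" where
  "curve_of C = shift_rel `` {C}"

definition complete_folding_curves :: "curve set" where
  "complete_folding_curves =
     {C. complete_curve C \<and> complete_folding_seq (turns C)} // shift_rel"

definition has_assoc_seq :: "curve \<Rightarrow> (int \<Rightarrow> int) \<Rightarrow> bool" where
  "has_assoc_seq K s \<longleftrightarrow> (\<exists>C\<in>K. turns C = s)"

definition segments_of :: "curve \<Rightarrow> segment set" where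
  "segments_of K = (\<Union>C\<in>K. range C)"

definition folding_covering :: "curve set \<Rightarrow> bool" where
  "folding_covering \<C> \<longleftrightarrow>
     \<C> \<subseteq> complete_folding_curves \<and>
     (\<forall>e\<in>unit_edges. \<exists>!(K, c). K \<in> \<C> \<and> c \<in> segments_of K \<and> support c = e)"

(* A segment with the support of its predecessor (at the initial point) and the
   support of its successor (at the terminal point). *)
type_synonym decorated_segment = "segment \<times> edge \<times> edge"

definition decorated_segments :: "curve set \<Rightarrow> decorated_segment set" where
  "decorated_segments \<C> =
     {(C i, support (C (i - 1)), support (C (i + 1))) | C i. C \<in> \<Union>\<C>}"

definition translate :: "point \<Rightarrow> decorated_segment \<Rightarrow> decorated_segment" where
  "translate v = (\<lambda>((p, q), e, f). ((v + p, v + q), (+) v ` e, (+) v ` f))"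

definition edge_points :: "edge \<Rightarrow> (real \<times> real) set" where
  "edge_points e = convex hull ((\<lambda>(x, y). (real_of_int x, real_of_int y)) ` e)"

definition decorated_points :: "decorated_segment \<Rightarrow> (real \<times> real) set" where
  "decorated_points = (\<lambda>(c, e, f). edge_points (support c) \<union> edge_points e \<union> edge_points f)"

definition local_isomorphism :: "curve set \<Rightarrow> bool" where
  "local_isomorphism \<C> \<longleftrightarrow>
     (\<forall>F. finite F \<and> F \<subseteq> decorated_segments \<C> \<longrightarrow>
       (\<exists>r>0. \<forall>z. \<exists>v. translate v ` F \<subseteq> decorated_segments \<C> \<and>
                      (\<Union>d\<in>translate v ` F. decorated_points d) \<subseteq> cball z r))"

end

theory Submission
  imports Defs
begin

text \<open>Identify the plane with the Gaussian integers so that the middle vertex of \<open>C\<close> is 0. Erasing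
  every second vertex of a folding curve gives a folding curve on the lattice generated by
  \<open>1 \<plusminus> i\<close>, so that every edge has a parent on the coarser lattice. Under repeated passage to
  parents, with rescaling, every edge falls into the square \<open>[-1, 1]\<^sup>2\<close>, whose twelve edges form a
  finite automaton driven by the letters \<open>a (2 ^ n)\<close>: the four edges at 0 are fixed, and the eight
  others are mapped to them, except that four survive when the letters alternate forever. Two edges
  belong to the same curve if and only if their ancestors finally agree or are joined at 0, whence
  two curves through 0 and none or four others.

  The same contraction shows that \<open>C\<close> alone covers arbitrarily large disks. By the local isomorphism
  property every finite part of the covering is therefore found inside \<open>C\<close>, which forces all curves
  to be oriented and to turn as the hierarchical structure of \<open>C\<close> prescribes.\<close>

subsection \<open>Edges and their parents\<close>

text \<open>In an \<infinity>-folding sequence the letter at 2 ^ m * (2 k + 1) is (-1) ^ k times the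
  letter at 2 ^ m: odd-indexed letters alternate, even-indexed ones form a sequence of the same
  kind. In the plane the alternation becomes a rule in the parities of the coordinates, so the turn
  of C depends on the vertex alone and is fixed at the first level at which the vertex drops out of
  the coarser lattice. Only 0 lies in all these lattices; its turn \<epsilon> is free. The obstacle
  is to impose this rule on the other curves, for which no hierarchy is given. A translation that
  carries a part of the covering into C need not respect the lattices; it is made to do so by
  carrying along a piece of C so long that its turns reveal the lattice of level k. At 0 no level
  suffices, and the turn is forced there because the edges of C are already taken. The parity
  convention gives every unit edge exactly one orientation, so all curves can be compared as classes
  of a single relation on edges.\<close>

definition sg :: "int \<Rightarrow> int" where
  "sg y = (if even y then 1 else -1)"

text \<open>An edge \<open>(x, y, d)\<close> starts at \<open>(x, y)\<close> and points in the direction \<open>(d, 0)\<close> if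
  \<open>x + y\<close> is even and \<open>(0, d)\<close> if it is odd: this parity is the same for all segments of a curve
  that turns by a right angle at each vertex.\<close>

type_synonym arc = "int \<times> int \<times> int"

fun is_arc :: "arc \<Rightarrow> bool" where
  "is_arc (x, y, d) \<longleftrightarrow> d = 1 \<or> d = -1"

fun start :: "arc \<Rightarrow> point" where
  "start (x, y, d) = (x, y)"

fun head :: "arc \<Rightarrow> point" where
  "head (x, y, d) = (if even (x + y) then (x + d, y) else (x, y + d))"

fun step :: "int \<Rightarrow> arc \<Rightarrow> arc" where
  "step t (x, y, d) = (if even (x + y) then (x + d, y, t * d) else (x, y + d, - (t * d)))"

text \<open>One step of unfolding: an edge of the coarse lattice is mapped by multiplication with
  \<open>1 + c i\<close> to a diagonal and then replaced by the two sides \<open>child0\<close>, \<open>child1\<close> of a unit square.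
  The factor depends on the first letter \<open>c\<close> of the folding sequence because then the edge from 0
  to 1 is its own parent.\<close>

fun child0 :: "int \<Rightarrow> arc \<Rightarrow> arc" where
  "child0 c (u, v, d) = (u - c * v, v + c * u, if even (u + v) then d else - (c * d))"

text \<open>The ordinate y of the child has the parity of u + v, so \<open>sg y\<close> tells images
  of horizontal edges from those of vertical ones. The turn \<open>c * sg y\<close> between the two
  sides thus alternates along a coarse curve, as the odd-indexed letters do.\<close>

definition child1 :: "int \<Rightarrow> arc \<Rightarrow> arc" where
  "child1 c e = (case child0 c e of (x, y, d) \<Rightarrow> (x + d, y, c * sg y * d))"

text \<open>Division by 1 + c i, that is, multiplication with (1 - c i) / 2.\<close>

fun par0 :: "int \<Rightarrow> arc \<Rightarrow> arc" where
  "par0 c (x, y, d) = ((x + c * y) div 2, (y - c * x) div 2,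
     if even ((x + c * y) div 2 + (y - c * x) div 2) then d else - (c * d))"

declare par0.simps [simp del]

text \<open>An edge starting at an odd vertex is a second side. It is replaced by the first side of
  the same diagonal; the factor \<open>c * sg y\<close> from \<open>child1\<close> is its own
  inverse.\<close>

fun par :: "int \<Rightarrow> arc \<Rightarrow> arc" where
  "par c (x, y, d) = (if even (x + y) then par0 c (x, y, d)
     else par0 c (x - c * sg y * d, y, c * sg y * d))"

fun odot :: "int \<Rightarrow> point \<Rightarrow> point" where
  "odot c (u, v) = (u - c * v, v + c * u)"

fun shift :: "point \<Rightarrow> arc \<Rightarrow> arc" where
  "shift (a, b) (x, y, d) = (a + x, b + y, d)"

lemma sg_simps [simp]: "even y \<Longrightarrow> sg y = 1" "odd y \<Longrightarrow> sg y = -1"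
  by (auto simp: sg_def)

lemma sg_cases: "sg y = 1 \<or> sg y = -1"
  by (auto simp: sg_def)

lemma is_arc_child0 [simp]: "c = 1 \<or> c = -1 \<Longrightarrow> is_arc e \<Longrightarrow> is_arc (child0 c e)"
  by (cases e) auto

lemma is_arc_child1 [simp]: "c = 1 \<or> c = -1 \<Longrightarrow> is_arc e \<Longrightarrow> is_arc (child1 c e)"
  by (cases e) (auto simp: child1_def sg_def)

lemma is_arc_step: "t = 1 \<or> t = -1 \<Longrightarrow> is_arc e \<Longrightarrow> is_arc (step t e)"
  by (cases e) auto

lemma is_arc_par: "c = 1 \<or> c = -1 \<Longrightarrow> is_arc e \<Longrightarrow> is_arc (par c e)"
  by (cases e) (auto simp: sg_def par0.simps)

lemma par_child0 [simp]:
  assumes "c = 1 \<or> c = -1"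
  shows "par c (child0 c e) = e"
proof -
  obtain u v d where e: "e = (u, v, d)" by (cases e)
  have half: "(u - c * v + c * (v + c * u)) div 2 = u" "(v + c * u - c * (u - c * v)) div 2 = v"
    using assms by (elim disjE; simp)+
  have ev: "even (u - c * v + (v + c * u))" using assms by auto
  have "- (c * - (c * d)) = d" using assms by auto
  then show ?thesis
    unfolding e child0.simps par.simps par0.simps if_P[OF ev] half by simp
qed

lemma child0_par:
  assumes "c = 1 \<or> c = -1" "is_arc e" "even (fst (start e) + snd (start e))"
  shows "child0 c (par c e) = e"
proof -
  obtain x y d where e: "e = (x, y, d)" by (cases e)
  with assms have "even (x + y)" by simp
  then obtain u where "x + y = 2 * u" by (elim evenE)
  then have "x = 2 * u - y" by simp
  with assms show ?thesis
    by (auto simp: e par0.simps algebra_simps)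
qed

lemma child1_eq:
  assumes "c = 1 \<or> c = -1"
  shows "child1 c e = step (c * sg (snd (start (child0 c e)))) (child0 c e)"
  using assms by (cases e) (auto simp: child1_def)

lemma par_child1 [simp]:
  assumes "c = 1 \<or> c = -1" "is_arc e"
  shows "par c (child1 c e) = e"
proof -
  obtain x y d where e: "child0 c e = (x, y, d)" by (cases "child0 c e")
  have "even (x + y)" "d = 1 \<or> d = -1"
    using assms e is_arc_child0[OF assms] by (cases e; auto)+
  moreover have "c * sg y * (c * sg y * d) = d"
    using assms(1) sg_cases[of y] by auto
  ultimately have "par c (child1 c e) = par c (child0 c e)"
    by (auto simp: child1_def e)
  with assms show ?thesis by simp
qed

lemma child1_par:
  assumes "c = 1 \<or> c = -1" "is_arc e" "odd (fst (start e) + snd (start e))"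
  shows "child1 c (par c e) = e"
proof -
  obtain x y d where e: "e = (x, y, d)" by (cases e)
  define x' d' where "x' = x - c * sg y * d" and "d' = c * sg y * d"
  have d': "d' = 1 \<or> d' = -1" using assms sg_cases[of y] by (auto simp: d'_def e)
  have "even (x' + y)" using assms by (auto simp: x'_def e sg_def)
  then have "par c e = par c (x', y, d')"
    using assms by (auto simp: e x'_def d'_def)
  then have "child0 c (par c e) = (x', y, d')"
    using child0_par[of c "(x', y, d')"] assms d' \<open>even (x' + y)\<close> by auto
  then show ?thesis
    using assms sg_cases[of y] by (auto simp: child1_def x'_def d'_def e)
qed

lemma arc_cases:
  assumes "c = 1 \<or> c = -1" "is_arc e"
  obtains q where "is_arc q" "e = child0 c q" | q where "is_arc q" "e = child1 c q"
  using child0_par[OF assms] child1_par[OF assms] is_arc_par[OF assms] by metis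

text \<open>If the coarse translation keeps the parity of vertices, the fine one changes ordinates
  by an even number and leaves \<open>sg\<close> alone, so children are translated to
  children.\<close>

lemma par_shift:
  assumes "c = 1 \<or> c = -1" "is_arc e" "even (fst w + snd w)"
  shows "par c (shift (odot c w) e) = shift w (par c e)"
proof -
  obtain x y where w: "w = (x, y)" by (cases w)
  have sh0: "shift (odot c w) (child0 c q) = child0 c (shift w q)" for q
    using assms by (cases q) (auto simp: w algebra_simps)
  have sh1: "shift (odot c w) (child1 c q) = child1 c (shift w q)" for q
  proof -
    obtain x0 y0 d0 where q: "child0 c q = (x0, y0, d0)" by (cases "child0 c q")
    have "child0 c (shift w q) = (x - c * y + x0, y + c * x + y0, d0)"
      using sh0[of q] by (simp add: w q)
    moreover have "sg (y + c * x + y0) = sg y0"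
      using assms(1,3) by (auto simp: w sg_def)
    ultimately show ?thesis by (simp add: child1_def w q)
  qed
  have arc: "is_arc (shift w q)" if "is_arc q" for q
    using that by (cases q) (auto simp: w)
  from assms(1,2) show ?thesis
    by (cases rule: arc_cases) (use assms sh0 sh1 arc in auto)
qed

text \<open>Four times the squared distance of the midpoint from 0.\<close>

fun size_arc :: "arc \<Rightarrow> int" where
  "size_arc (x, y, d) = (if even (x + y) then (2 * x + d)\<^sup>2 + (2 * y)\<^sup>2 else (2 * x)\<^sup>2 + (2 * y + d)\<^sup>2)"

text \<open>Multiplied by 1 + c i, the midpoint of the parent is the midpoint of the diagonal, with
  doubled squared norm. It differs from the midpoint of the side by half a unit in one coordinate,
  whence k.\<close>

lemma size_arc_child0:
  assumes "c = 1 \<or> c = -1" "is_arc e" "child0 c e = (x, y, d)"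
  shows "size_arc (child0 c e) = (2 * x + d)\<^sup>2 + (2 * y)\<^sup>2"
    "\<exists>k. (k = 1 \<or> k = -1) \<and> 2 * size_arc e = (2 * x + d)\<^sup>2 + (2 * y + k)\<^sup>2"
proof -
  obtain u v b where e: "e = (u, v, b)" by (cases e)
  have eq: "x = u - c * v" "y = v + c * u" "d = (if even (u + v) then b else - (c * b))"
    using assms by (auto simp: e)
  show "size_arc (child0 c e) = (2 * x + d)\<^sup>2 + (2 * y)\<^sup>2"
    using assms eq by auto
  have "2 * size_arc e = (2 * x + d)\<^sup>2 + (2 * y + (if even (u + v) then c * d else - (c * d)))\<^sup>2"
  proof (cases "even (u + v)")
    case True
    then have "size_arc e = (2 * u + b)\<^sup>2 + (2 * v)\<^sup>2" by (simp add: e)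
    with True assms(1) show ?thesis by (auto simp: eq power2_eq_square algebra_simps)
  next
    case False
    then have "size_arc e = (2 * u)\<^sup>2 + (2 * v + b)\<^sup>2" by (simp add: e)
    with False assms(1) show ?thesis by (auto simp: eq power2_eq_square algebra_simps)
  qed
  moreover have "(if even (u + v) then c * d else - (c * d)) \<in> {1, -1}"
    using assms eq by (auto simp: e)
  ultimately show "\<exists>k. (k = 1 \<or> k = -1) \<and> 2 * size_arc e = (2 * x + d)\<^sup>2 + (2 * y + k)\<^sup>2"
    by auto
qed

lemma size_arc_child1:
  assumes "c = 1 \<or> c = -1" "is_arc e" "child1 c e = (x, y, d)"
  shows "size_arc (child1 c e) = (2 * x)\<^sup>2 + (2 * y + d)\<^sup>2"
    "\<exists>k. (k = 1 \<or> k = -1) \<and> 2 * size_arc e = (2 * x + k)\<^sup>2 + (2 * y + d)\<^sup>2"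
proof -
  obtain u v b where e: "e = (u, v, b)" by (cases e)
  obtain x0 y0 d0 where e0: "child0 c e = (x0, y0, d0)" by (cases "child0 c e")
  have eq: "x0 = u - c * v" "y0 = v + c * u" "d0 = (if even (u + v) then b else - (c * b))"
    using e0 by (auto simp: e)
  have eq1: "x = x0 + d0" "y = y0" "d = c * sg y0 * d0"
    using e0 assms(3) by (auto simp: child1_def)
  have y0: "even y0 \<longleftrightarrow> even (u + v)" using eq assms(1) by auto
  show "size_arc (child1 c e) = (2 * x)\<^sup>2 + (2 * y + d)\<^sup>2"
    using assms eq by (auto simp: eq1 e)
  have "2 * size_arc e = (2 * x - d0)\<^sup>2 + (2 * y + d)\<^sup>2"
  proof (cases "even (u + v)")
    case True
    then have "size_arc e = (2 * u + b)\<^sup>2 + (2 * v)\<^sup>2" by (simp add: e)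
    moreover have "d0 = b" "d = c * b" using True y0 by (auto simp: eq1 eq(3))
    ultimately show ?thesis using assms(1) by (auto simp: eq1(1,2) eq(1,2) power2_eq_square algebra_simps)
  next
    case False
    then have "size_arc e = (2 * u)\<^sup>2 + (2 * v + b)\<^sup>2" by (simp add: e)
    moreover have "d0 = - (c * b)" "d = b" using False y0 assms(1) by (auto simp: eq1 eq(3))
    ultimately show ?thesis using assms(1) by (auto simp: eq1(1,2) eq(1,2) power2_eq_square algebra_simps)
  qed
  moreover have "d0 \<in> {1, -1}"
    using assms eq by (auto simp: e)
  ultimately show "\<exists>k. (k = 1 \<or> k = -1) \<and> 2 * size_arc e = (2 * x + k)\<^sup>2 + (2 * y + d)\<^sup>2"
    by (auto intro: exI[of _ "- d0"])
qed

text \<open>Otherwise completing the square gives X^2 + (Y - k)^2 at most 2, which leaves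
  \<bar>X\<bar> \<le> 1 and \<bar>Y\<bar> \<le> 2. The resulting bound 5 is the size of the outer
  edges of the square.\<close>

lemma halved_square_less:
  fixes X Y k :: int
  assumes "k = 1 \<or> k = -1" "2 * s = X\<^sup>2 + (Y + k)\<^sup>2" "X\<^sup>2 + Y\<^sup>2 > 5"
  shows "s < X\<^sup>2 + Y\<^sup>2"
proof (rule ccontr)
  assume "\<not> s < X\<^sup>2 + Y\<^sup>2"
  then have "X\<^sup>2 + (Y - k)\<^sup>2 \<le> 2"
    using assms(1,2) by (auto simp: power2_eq_square algebra_simps)
  moreover have "\<bar>X\<bar> \<le> 1"
  proof (rule ccontr)
    assume "\<not> \<bar>X\<bar> \<le> 1"
    then have "2\<^sup>2 \<le> \<bar>X\<bar>\<^sup>2" by (intro power_mono) auto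
    with calculation show False using zero_le_power2[of "Y - k"] by simp
  qed
  moreover have "\<bar>Y - k\<bar> \<le> 1"
  proof (rule ccontr)
    assume "\<not> \<bar>Y - k\<bar> \<le> 1"
    then have "2\<^sup>2 \<le> \<bar>Y - k\<bar>\<^sup>2" by (intro power_mono) auto
    with calculation(1) show False using zero_le_power2[of X] by simp
  qed
  ultimately have "\<bar>X\<bar> \<le> 1" "\<bar>Y\<bar> \<le> 2" using assms(1) by auto
  then have "\<bar>X\<bar>\<^sup>2 \<le> 1\<^sup>2" "\<bar>Y\<bar>\<^sup>2 \<le> 2\<^sup>2" by (intro power_mono; simp)+
  with assms(3) show False by simp
qed

lemma size_arc_par_less:
  assumes "c = 1 \<or> c = -1" "is_arc e" "size_arc e > 5"
  shows "size_arc (par c e) < size_arc e"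
  using assms(1,2)
proof (cases rule: arc_cases)
  case (1 q)
  obtain x y d where q: "child0 c q = (x, y, d)" by (cases "child0 c q")
  show ?thesis
    using size_arc_child0[OF assms(1) 1(1) q] halved_square_less[of _ "size_arc q" "2 * x + d" "2 * y"] assms 1
    by auto
next
  case (2 q)
  obtain x y d where q: "child1 c q = (x, y, d)" by (cases "child1 c q")
  show ?thesis
    using size_arc_child1[OF assms(1) 2(1) q] halved_square_less[of _ "size_arc q" "2 * y + d" "2 * x"] assms 2
    by (auto simp: add.commute)
qed

text \<open>The edges at 0, and all edges of the square \<open>[-1, 1]\<^sup>2\<close>.\<close>

definition center_arcs :: "arc set" where
  "center_arcs = {(0, 0, 1), (0, 0, -1), (0, 1, -1), (0, -1, 1)}"

definition square_arcs :: "arc set" where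
  "square_arcs = center_arcs \<union> {(1, 0, 1), (1, 0, -1), (-1, 0, 1), (-1, 0, -1),
     (1, 1, -1), (1, -1, -1), (-1, 1, 1), (-1, -1, 1)}"

lemma square_arcs_if_size_le:
  assumes "is_arc e" "size_arc e \<le> 5"
  shows "e \<in> square_arcs"
proof -
  obtain x y d where e: "e = (x, y, d)" by (cases e)
  define X Y where "X = (if even (x + y) then 2 * x + d else 2 * x)"
    and "Y = (if even (x + y) then 2 * y else 2 * y + d)"
  have "X\<^sup>2 + Y\<^sup>2 \<le> 5" using assms by (auto simp: e X_def Y_def)
  have small: "\<bar>Z\<bar> \<le> 2" if "Z\<^sup>2 \<le> 5" for Z :: int
  proof (rule ccontr)
    assume "\<not> \<bar>Z\<bar> \<le> 2"
    then have "3\<^sup>2 \<le> \<bar>Z\<bar>\<^sup>2" by (intro power_mono) auto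
    with that show False by simp
  qed
  have "\<bar>X\<bar> \<le> 2" "\<bar>Y\<bar> \<le> 2"
    using \<open>X\<^sup>2 + Y\<^sup>2 \<le> 5\<close> by (auto intro!: small intro: order_trans[rotated])
  moreover have "d = 1 \<or> d = -1" using assms by (auto simp: e)
  ultimately have "-1 \<le> x \<and> x \<le> 1" "-1 \<le> y \<and> y \<le> 1"
    by (auto simp: X_def Y_def split: if_splits)
  then have "x = -1 \<or> x = 0 \<or> x = 1" "y = -1 \<or> y = 0 \<or> y = 1" by linarith+
  then show ?thesis using \<open>d = 1 \<or> d = -1\<close> assms(2)
    unfolding e by (elim disjE) (simp_all add: square_arcs_def center_arcs_def)
qed

lemma par_center: "e \<in> center_arcs \<Longrightarrow> c = 1 \<or> c = -1 \<Longrightarrow> par c e = e"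
  by (auto simp: center_arcs_def par0.simps)

text \<open>The transition table on the outer edges. Either letter sends four of them to the centre
  and carries the other four onto those which the opposite letter leaves outside.\<close>

lemma par_square:
  "par c (0, 0, 1) = (0, 0, 1)" "par c (0, 0, -1) = (0, 0, -1)"
  "par 1 (1, 0, 1) = (0, 0, 1)" "par (-1) (1, 0, 1) = (1, 1, -1)"
  "par 1 (1, 0, -1) = (1, -1, -1)" "par (-1) (1, 0, -1) = (0, 0, 1)"
  "par 1 (-1, 0, 1) = (-1, 1, 1)" "par (-1) (-1, 0, 1) = (0, 0, -1)"
  "par 1 (-1, 0, -1) = (0, 0, -1)" "par (-1) (-1, 0, -1) = (-1, -1, 1)"
  "par 1 (1, 1, -1) = (1, 0, 1)" "par (-1) (1, 1, -1) = (0, 1, -1)"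
  "par 1 (1, -1, -1) = (0, -1, 1)" "par (-1) (1, -1, -1) = (1, 0, -1)"
  "par 1 (-1, 1, 1) = (0, 1, -1)" "par (-1) (-1, 1, 1) = (-1, 0, 1)"
  "par 1 (-1, -1, 1) = (-1, 0, -1)" "par (-1) (-1, -1, 1) = (0, -1, 1)"
  by (simp_all add: par0.simps)

lemma par_square_arcs: "e \<in> square_arcs \<Longrightarrow> c = 1 \<or> c = -1 \<Longrightarrow> par c e \<in> square_arcs"
  by (auto simp: square_arcs_def center_arcs_def par0.simps)

subsection \<open>The hierarchical turn function\<close>

lemma odd_sg [simp]: "odd (sg k)"
  by (simp add: sg_def)

lemma sg_add_1 [simp]: "sg (k + 1) = - sg k"
  by (simp add: sg_def)

lemma head_child1:
  assumes "c = 1 \<or> c = -1" "is_arc q"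
  shows "head (child1 c q) = odot c (head q)"
proof -
  obtain u v d where q: "q = (u, v, d)" by (cases q)
  have y: "even (v + c * u) \<longleftrightarrow> even (u + v)" using assms by auto
  show ?thesis
    using assms y by (cases "even (u + v)") (auto simp: q child1_def)
qed

lemma start_child0 [simp]: "start (child0 c q) = odot c (start q)"
  by (cases q) auto

lemma start_step [simp]: "start (step t e) = head e"
  by (cases e) auto

lemma step_child1:
  assumes "c = 1 \<or> c = -1" "is_arc q"
  shows "step t (child1 c q) = child0 c (step t q)"
proof -
  obtain u v d where q: "q = (u, v, d)" by (cases q)
  have y: "even (v + c * u) \<longleftrightarrow> even (u + v)" using assms by auto
  show ?thesis
    using assms y by (cases "even (u + v)") (auto simp: q child1_def)
qed

lemma step_inject:
  assumes "t = 1 \<or> t = -1" "step t e = step t f"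
  shows "e = f"
  using assms by (cases e; cases f) (auto split: if_splits)

section \<open>Divisibility by 1 \<plusminus> i and the squared norm\<close>

definition sqnorm :: "point \<Rightarrow> int" where
  "sqnorm p = (fst p)\<^sup>2 + (snd p)\<^sup>2"

lemma sqnorm_odot: "c = 1 \<or> c = -1 \<Longrightarrow> sqnorm (odot c p) = 2 * sqnorm p"
  by (cases p) (auto simp: sqnorm_def power2_eq_square algebra_simps)

lemma sqnorm_pos: "p \<noteq> (0, 0) \<Longrightarrow> sqnorm p > 0"
  by (cases p) (auto simp: sqnorm_def sum_power2_gt_zero_iff)

lemma even_point_odot:
  assumes "c = 1 \<or> c = -1" "even (fst p + snd p)"
  obtains q where "p = odot c q"
proof -
  obtain u where "fst p + snd p = 2 * u" using assms(2) by (elim evenE)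
  then have "p = (2 * u - snd p, snd p)" by (cases p) auto
  moreover have "(2 * u - y, y) = odot c (if c = 1 then (u, y - u) else (u - y, u))" for y
    using assms(1) by auto
  ultimately show ?thesis using that by metis
qed

lemma odot_eq_0 [simp]: "c = 1 \<or> c = -1 \<Longrightarrow> odot c p = (0, 0) \<longleftrightarrow> p = (0, 0)"
  by (cases p) auto

lemma even_odot: "c = 1 \<or> c = -1 \<Longrightarrow> even (fst (odot c p) + snd (odot c p))"
  by (cases p) auto

fun unodot :: "int \<Rightarrow> point \<Rightarrow> point" where
  "unodot c (x, y) = ((x + c * y) div 2, (y - c * x) div 2)"

declare unodot.simps [simp del]

lemma unodot_odot [simp]: 
  assumes "c = 1 \<or> c = -1" shows "unodot c (odot c p) = p"
proof -
  obtain u v where p: "p = (u, v)" by (cases p)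
  have "(u - c * v + c * (v + c * u)) div 2 = u" "(v + c * u - c * (u - c * v)) div 2 = v"
    using assms by (elim disjE; simp)+
  then show ?thesis by (simp add: p unodot.simps)
qed

lemma sqnorm_unodot:
  assumes "c = 1 \<or> c = -1" "even (fst p + snd p)" "p \<noteq> (0, 0)"
  shows "sqnorm (unodot c p) < sqnorm p"
proof -
  obtain q where q: "p = odot c q" using even_point_odot[OF assms(1,2)] .
  then show ?thesis using assms sqnorm_odot[of c q] sqnorm_pos[of q] by simp
qed

text \<open>Here \<open>\<alpha> n\<close> stands for \<open>a (2 ^ n)\<close>, and \<open>turn n\<close> gives the turns at the vertices of the \<open>n\<close>-th
  derivative of the covering, rescaled to the unit lattice with centre 0.\<close>

locale folding_plane =
  fixes \<alpha> :: "nat \<Rightarrow> int" and \<epsilon> :: int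
  assumes \<alpha>: "\<alpha> n = 1 \<or> \<alpha> n = -1" and \<epsilon>: "\<epsilon> = 1 \<or> \<epsilon> = -1"
begin

function turn :: "nat \<Rightarrow> point \<Rightarrow> int" where
  "turn n p = (if p = (0, 0) then \<epsilon> else if odd (fst p + snd p) then \<alpha> n * sg (snd p)
     else turn (Suc n) (unodot (\<alpha> n) p))"
  by auto
termination
proof (relation "Wellfounded.measure (\<lambda>(n, p). nat (sqnorm p))", goal_cases)
  case (2 n p)
  then show ?case using sqnorm_unodot[OF \<alpha>[of n], of p] sqnorm_pos[of p] by auto
qed simp

declare turn.simps [simp del]

lemma turn_0 [simp]: "turn n (0, 0) = \<epsilon>"
  by (simp add: turn.simps)

lemma turn_odd: "odd (fst p + snd p) \<Longrightarrow> turn n p = \<alpha> n * sg (snd p)"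
  by (subst turn.simps) auto

lemma turn_odot [simp]: "turn n (odot (\<alpha> n) p) = turn (Suc n) p"
  by (subst turn.simps) (use \<alpha>[of n] even_odot[of "\<alpha> n" p] in auto)

lemma turn_cases: "turn n p = 1 \<or> turn n p = -1"
proof (induction n p rule: turn.induct)
  case (1 n p)
  then show ?case
    by (subst (1 2) turn.simps) (use \<epsilon> \<alpha>[of n] sg_cases[of "snd p"] in auto)
qed

definition nxt :: "nat \<Rightarrow> arc \<Rightarrow> arc" where
  "nxt n e = step (turn n (head e)) e"

lemma start_nxt [simp]: "start (nxt n e) = head e"
  by (simp add: nxt_def)

lemma is_arc_nxt [simp]: "is_arc e \<Longrightarrow> is_arc (nxt n e)"
  by (simp add: nxt_def is_arc_step turn_cases)

lemma nxt_inject: "nxt n e = nxt n f \<Longrightarrow> e = f"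
  by (metis nxt_def start_nxt step_inject turn_cases)

text \<open>A first side ends at an odd vertex, where the letter of the current level
  decides.\<close>

lemma nxt_child0:
  assumes "is_arc q"
  shows "nxt n (child0 (\<alpha> n) q) = child1 (\<alpha> n) q"
proof -
  obtain x y d where e: "child0 (\<alpha> n) q = (x, y, d)" by (cases "child0 (\<alpha> n) q")
  have "(x, y) = odot (\<alpha> n) (start q)"
    using start_child0[of "\<alpha> n" q] e by (simp del: start_child0)
  then have "is_arc (x, y, d)" "even (x + y)"
    using is_arc_child0[OF \<alpha>[of n] assms] even_odot[OF \<alpha>[of n], of "start q"] e
    by (metis, metis fst_conv snd_conv)
  then have "turn n (head (x, y, d)) = \<alpha> n * sg y"
    using turn_odd[of "(x + d, y)" n] by auto
  then show ?thesis
    using \<open>even (x + y)\<close> by (simp add: nxt_def child1_def e)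
qed

text \<open>A second side ends at the image of the end of its parent, so its turn is inherited from
  the next level.\<close>

lemma nxt_child1:
  assumes "is_arc q"
  shows "nxt n (child1 (\<alpha> n) q) = child0 (\<alpha> n) (nxt (Suc n) q)"
  using assms by (simp add: nxt_def head_child1 step_child1 \<alpha>)

definition up :: "nat \<Rightarrow> arc \<Rightarrow> arc" where
  "up n = par (\<alpha> n)"

lemma is_arc_up [simp]: "is_arc e \<Longrightarrow> is_arc (up n e)"
  by (simp add: up_def is_arc_par \<alpha>)

lemma level_cases:
  assumes "is_arc e"
  obtains "e = child0 (\<alpha> n) (up n e)" "odd (fst (head e) + snd (head e))"
  | "e = child1 (\<alpha> n) (up n e)" "even (fst (head e) + snd (head e))"
proof (cases "even (fst (start e) + snd (start e))")
  case True
  then have "odd (fst (head e) + snd (head e))" using assms by (cases e) auto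
  with that(1) child0_par[OF \<alpha> assms True, of n] show ?thesis by (simp add: up_def)
next
  case False
  then have "even (fst (head e) + snd (head e))" using assms by (cases e) auto
  with that(2) child1_par[OF \<alpha> assms False, of n] show ?thesis by (simp add: up_def)
qed

lemma up_child [simp]: 
  "up n (child0 (\<alpha> n) q) = q" "is_arc q \<Longrightarrow> up n (child1 (\<alpha> n) q) = q"
  by (simp_all add: up_def \<alpha>)

lemma up_nxt:
  assumes "is_arc e"
  shows "odd (fst (head e) + snd (head e)) \<Longrightarrow> up n (nxt n e) = up n e"
    "even (fst (head e) + snd (head e)) \<Longrightarrow> up n (nxt n e) = nxt (Suc n) (up n e) \<and> head e = odot (\<alpha> n) (head (up n e))"
proof -
  have q: "is_arc (up n e)" using assms by simp
  from assms show "odd (fst (head e) + snd (head e)) \<Longrightarrow> up n (nxt n e) = up n e"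
    by (cases rule: level_cases[of _ n]) (use nxt_child0[OF q, of n] q up_child in metis)+
  from assms show "even (fst (head e) + snd (head e)) \<Longrightarrow> up n (nxt n e) = nxt (Suc n) (up n e) \<and> head e = odot (\<alpha> n) (head (up n e))"
    by (cases rule: level_cases[of _ n]) (use nxt_child1[OF q, of n] q up_child head_child1[OF \<alpha>, OF q] in metis)+
qed

text \<open>The closed form of a two-sided folding sequence with letters \<open>\<alpha> n\<close>,
  \<open>\<alpha> (n + 1)\<close>, ... at the powers of 2. Antisymmetry in the index is contained in
  \<open>sg (- k - 1) = - sg k\<close>.\<close>

definition toeplitz :: "nat \<Rightarrow> (int \<Rightarrow> int) \<Rightarrow> bool" where
  "toeplitz n s \<longleftrightarrow> s 0 = \<epsilon> \<and> (\<forall>m k. s (2 ^ m * (2 * k + 1)) = sg k * \<alpha> (n + m))"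

lemma toeplitz_odd: "toeplitz n s \<Longrightarrow> s (2 * k + 1) = sg k * \<alpha> n"
  unfolding toeplitz_def by (metis add.right_neutral mult_1 power_0)

lemma toeplitz_even: "toeplitz n s \<Longrightarrow> toeplitz (Suc n) (\<lambda>h. s (2 * h))"
  unfolding toeplitz_def by (metis add_Suc_shift mult.assoc mult_zero_right power_Suc)

text \<open>The letter \<open>s h\<close> is read at the start of \<open>w h\<close>, so \<epsilon>
  belongs to the vertex where \<open>w 0\<close> begins.\<close>

definition walk :: "(int \<Rightarrow> int) \<Rightarrow> (int \<Rightarrow> arc) \<Rightarrow> bool" where
  "walk s w \<longleftrightarrow> (\<forall>h. is_arc (w h) \<and> w (h + 1) = step (s (h + 1)) (w h))"

text \<open>Two consecutive steps change each coordinate by one.\<close>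

lemma walk_parity:
  assumes "walk s w"
  shows "(even (fst (start (w (h + 2 * k))) + snd (start (w (h + 2 * k)))) \<longleftrightarrow> even (fst (start (w h)) + snd (start (w h))))
    \<and> sg (snd (start (w (h + 2 * k)))) = sg k * sg (snd (start (w h)))"
proof -
  have two: "(even (fst (start (w (g + 2))) + snd (start (w (g + 2)))) \<longleftrightarrow> even (fst (start (w g)) + snd (start (w g))))
    \<and> sg (snd (start (w (g + 2)))) = - sg (snd (start (w g)))" for g
  proof -
    obtain x y d where 0: "w g = (x, y, d)" by (cases "w g")
    obtain x1 y1 d1 where 1: "w (g + 1) = (x1, y1, d1)" by (cases "w (g + 1)")
    have st: "w (g + 1) = step (s (g + 1)) (w g)" "w (g + 2) = step (s (g + 2)) (w (g + 1))"
      and arcs: "is_arc (w g)" "is_arc (w (g + 1))"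
      using assms unfolding walk_def by (metis add.assoc one_add_one)+
    have "start (w (g + 1)) = head (w g)" "start (w (g + 2)) = head (w (g + 1))"
      unfolding st by simp_all
    then show ?thesis using arcs 0 1 
      by (cases "even (x + y)") (auto simp: sg_def)
  qed
  show ?thesis
  proof (induction k rule: int_induct[of _ 0])
    case (step1 i)
    have "h + 2 * (i + 1) = (h + 2 * i) + 2" by simp
    then show ?case using step1 two[of "h + 2 * i"] by (metis minus_mult_left sg_add_1)
  next
    case (step2 i)
    have "h + 2 * i = (h + 2 * (i - 1)) + 2" by simp
    moreover have "sg (i - 1) = - sg i" by (simp add: sg_def)
    ultimately show ?case using step2 two[of "h + 2 * (i - 1)"] by (metis minus_mult_left minus_minus)
  qed auto
qed

text \<open>With \<open>w 0\<close> at the origin, the ordinate of the start of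
  \<open>w (2 * k)\<close> has the parity of k. Hence
  \<open>s (2 * k + 1) = sg k * \<alpha> n\<close> is exactly the turn between the two sides of a
  diagonal.\<close>

lemma walk_derive:
  assumes "walk s w" "toeplitz n s" "w 0 = (0, 0, 1)"
  defines "w' \<equiv> \<lambda>k. up n (w (2 * k))"
  shows "walk (\<lambda>h. s (2 * h)) w'" "w' 0 = (0, 0, 1)" "w (2 * k) = child0 (\<alpha> n) (w' k)"
    "w (2 * k + 1) = child1 (\<alpha> n) (w' k)"
proof -
  have arc: "is_arc (w h)" and st: "w (h + 1) = step (s (h + 1)) (w h)" for h
    using assms(1) by (auto simp: walk_def)
  have par: "even (fst (start (w (2 * k))) + snd (start (w (2 * k))))" "sg (snd (start (w (2 * k)))) = sg k" for k
    using walk_parity[OF assms(1), of 0 k] assms(3) by simp_all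
  show c0: "w (2 * k) = child0 (\<alpha> n) (w' k)" for k
    using child0_par[OF \<alpha> arc par(1)] by (simp add: w'_def up_def)
  have arc': "is_arc (w' k)" for k by (simp add: w'_def arc)
  show c1: "w (2 * k + 1) = child1 (\<alpha> n) (w' k)" for k
    using st[of "2 * k"] par(2)[of k] toeplitz_odd[OF assms(2), of k]
    unfolding c0 by (simp add: child1_eq \<alpha> mult.commute)
  have "w' (k + 1) = step (s (2 * (k + 1))) (w' k)" for k
  proof -
    have "w (2 * (k + 1)) = step (s (2 * (k + 1))) (w (2 * k + 1))"
      using st[of "2 * k + 1"] by (simp add: algebra_simps)
    also have "\<dots> = child0 (\<alpha> n) (step (s (2 * (k + 1))) (w' k))"
      unfolding c1 using step_child1[OF \<alpha> arc'] by simp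
    finally show ?thesis unfolding w'_def by simp
  qed
  with arc' show "walk (\<lambda>h. s (2 * h)) w'" by (simp add: walk_def)
  show "w' 0 = (0, 0, 1)" using \<alpha>[of n] by (auto simp: w'_def assms(3) up_def par0.simps)
qed

lemma walk_turn:
  assumes "walk s w" "toeplitz n s" "w 0 = (0, 0, 1)"
  shows "turn n (start (w h)) = s h"
  using assms
proof (induction "nat \<bar>h\<bar>" arbitrary: h n s w rule: less_induct)
  case less
  show ?case
  proof (cases "even h")
    case False
    then obtain k where h: "h = 2 * k + 1" by (elim oddE)
    have arc: "is_arc (w (2 * k))" and st: "w h = step (s h) (w (2 * k))"
      using less.prems(1) unfolding walk_def h by auto
    obtain x y d where e: "w (2 * k) = (x, y, d)" by (cases "w (2 * k)")
    have "even (x + y)" "sg y = sg k"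
      using walk_parity[OF less.prems(1), of 0 k] less.prems(3) e by simp_all
    moreover have "start (w h) = head (w (2 * k))" unfolding st by simp
    ultimately have "start (w h) = (x + d, y)" "odd (x + d + y)" using e arc by auto
    then show ?thesis
      using turn_odd[of "(x + d, y)" n] toeplitz_odd[OF less.prems(2), of k] \<open>sg y = sg k\<close> h by simp
  next
    case True
    then obtain k where h: "h = 2 * k" by (elim evenE)
    show ?thesis
    proof (cases "h = 0")
      case True
      then show ?thesis using less.prems by (simp add: toeplitz_def)
    next
      case False
      note d = walk_derive[OF less.prems]
      have "turn (Suc n) (start (up n (w (2 * k)))) = s (2 * k)"
        using less.hyps[of k, OF _ d(1) toeplitz_even[OF less.prems(2)] d(2)] False h by auto
      moreover have "start (w h) = odot (\<alpha> n) (start (up n (w (2 * k))))"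
        using arg_cong[OF d(3)[of k], of start] h by simp
      ultimately show ?thesis using h by simp
    qed
  qed
qed

lemma walk_nxt:
  assumes "walk s w" "toeplitz n s" "w 0 = (0, 0, 1)"
  shows "w (h + 1) = nxt n (w h)"
proof -
  have st: "w (h + 1) = step (s (h + 1)) (w h)" using assms(1) by (simp add: walk_def)
  moreover have "start (w (h + 1)) = head (w h)" unfolding st by simp
  ultimately show ?thesis using walk_turn[OF assms, of "h + 1"] by (simp add: nxt_def)
qed

text \<open>One of i, i + 1 is odd, and the letters at \<open>2 * (2 * k + 1)\<close> alternate. The
  letters at odd indices, in contrast, do repeat with period 4; this makes the parity of an index
  visible in the letters.\<close>

lemma toeplitz_not_alternating:
  assumes "toeplitz n s"
  shows "\<not> (s (2 * i) = s (2 * (i + 2)) \<and> s (2 * (i + 1)) = s (2 * (i + 3)))"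
proof -
  have flip: "s (2 * (2 * k + 1)) = - s (2 * (2 * k + 1 + 2))" for k
    using toeplitz_odd[OF toeplitz_even[OF assms], of k] toeplitz_odd[OF toeplitz_even[OF assms], of "k + 1"]
    by (simp add: sg_def algebra_simps)
  have nz: "s (2 * (2 * k + 1)) \<noteq> 0" for k
    using toeplitz_odd[OF toeplitz_even[OF assms], of k] \<alpha>[of "Suc n"] sg_cases[of k] by auto
  show ?thesis
  proof (cases "even i")
    case True
    then obtain k where "i = 2 * k" by (elim evenE)
    then show ?thesis using flip[of k] nz[of k] by (auto simp: algebra_simps)
  next
    case False
    then obtain k where "i = 2 * k + 1" by (elim oddE)
    then show ?thesis using flip[of k] nz[of k] by (auto simp: algebra_simps)
  qed
qed

text \<open>A converse of \<open>walk_turn\<close>, by descent: from an odd start all even-indexed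
  letters would be read at odd vertices and alternate; from an even start other than 0 the derived
  walk has half the squared norm. It confines the curves with sequence S to those through 0.\<close>

lemma walk_start_0:
  assumes "walk s w" "toeplitz n s" "\<And>h. turn n (start (w h)) = s h"
  shows "start (w 0) = (0, 0)"
  using assms
proof (induction "nat (sqnorm (start (w 0)))" arbitrary: n s w rule: less_induct)
  case less
  have arc: "is_arc (w h)" and st: "w (h + 1) = step (s (h + 1)) (w h)" for h
    using less.prems(1) by (auto simp: walk_def)
  have nx: "w (h + 1) = nxt n (w h)" for h
    using st[of h] less.prems(3)[of "h + 1"] start_step by (metis nxt_def)
  show ?case
  proof (cases "even (fst (start (w 0)) + snd (start (w 0)))")
    case False
    have "s (2 * k) = \<alpha> n * (sg k * sg (snd (start (w 0))))" for k
      using walk_parity[OF less.prems(1), of 0 k] False less.prems(3)[of "2 * k"]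
        turn_odd[of "start (w (2 * k))" n] by simp
    from this[of 0] this[of 1] this[of 2] this[of 3]
    have "s (2 * 0) = s (2 * (0 + 2)) \<and> s (2 * (0 + 1)) = s (2 * (0 + 3))"
      by (simp add: sg_def)
    then show ?thesis using toeplitz_not_alternating[OF less.prems(2), of 0] by blast
  next
    case True
    define w' where "w' k = up n (w (2 * k))" for k
    have c0: "w (2 * k) = child0 (\<alpha> n) (w' k)" for k
      using child0_par[OF \<alpha> arc] walk_parity[OF less.prems(1), of 0 k] True by (simp add: w'_def up_def)
    have arc': "is_arc (w' k)" for k by (simp add: w'_def arc)
    have nx': "w' (k + 1) = nxt (Suc n) (w' k)" for k
    proof -
      have "w (2 * (k + 1)) = nxt n (nxt n (w (2 * k)))"
        using nx[of "2 * k"] nx[of "2 * k + 1"] by (simp add: algebra_simps)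
      also have "\<dots> = child0 (\<alpha> n) (nxt (Suc n) (w' k))"
        by (simp add: c0 nxt_child0 nxt_child1 arc')
      finally show ?thesis unfolding w'_def[of "k + 1"] by simp
    qed
    have t': "turn (Suc n) (start (w' k)) = s (2 * k)" for k
      using less.prems(3)[of "2 * k"] by (simp add: c0)
    have "walk (\<lambda>h. s (2 * h)) w'"
      unfolding walk_def using arc' nx' t' by (metis nxt_def start_nxt)
    moreover have "start (w 0) = odot (\<alpha> n) (start (w' 0))"
      using c0[of 0] by simp
    moreover have "sqnorm (start (w' 0)) < sqnorm (start (w 0))" if "start (w 0) \<noteq> (0, 0)"
      using that \<alpha>[of n] sqnorm_odot[OF \<alpha>[of n], of "start (w' 0)"] sqnorm_pos[of "start (w' 0)"] calculation(2) by auto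
    ultimately show ?thesis
      using less.hyps[of w' "\<lambda>h. s (2 * h)" "Suc n"] toeplitz_even[OF less.prems(2)] t' \<alpha>[of n]
        sqnorm_pos[of "start (w 0)"] by fastforce
  qed
qed

text \<open>An odd j would bring the alternating letters to even indices. For even j the
  even-indexed letters pose the same problem at the next level with half the window.\<close>

lemma toeplitz_recognizable:
  assumes "toeplitz n s" "\<And>h. 0 \<le> h \<Longrightarrow> h \<le> 8 * 2 ^ m \<Longrightarrow> s (j + h) = s h"
  shows "2 ^ m dvd j"
  using assms
proof (induction m arbitrary: n s j)
  case (Suc m)
  \<comment> \<open>The four letters needed for the contradiction are at 1, 3, 5, 7, so 8
    suffices.\<close>
  have le8: "(8::int) \<le> 8 * 2 ^ Suc m" using one_le_power[of "2::int" "Suc m"] by simp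
  have "even j"
  proof (rule ccontr)
    assume "odd j"
    then obtain i where j: "j = 2 * i + 1" by (elim oddE)
    have "s (2 * (i + 1 + l)) = sg l * \<alpha> n" if "0 \<le> l" "l \<le> 3" for l
      using Suc.prems(2)[of "2 * l + 1"] toeplitz_odd[OF Suc.prems(1), of l] that le8 j
      by (simp add: algebra_simps)
    from this[of 0] this[of 1] this[of 2] this[of 3] show False
      using toeplitz_not_alternating[OF Suc.prems(1), of "i + 1"] by (simp add: sg_def algebra_simps)
  qed
  then obtain i where j: "j = 2 * i" by (elim evenE)
  have "2 ^ m dvd i"
  proof (rule Suc.IH[OF toeplitz_even[OF Suc.prems(1)]])
    fix h :: int assume "0 \<le> h" "h \<le> 8 * 2 ^ m"
    then show "s (2 * (i + h)) = s (2 * h)"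
      using Suc.prems(2)[of "2 * h"] by (simp add: j algebra_simps)
  qed
  then show ?case by (simp add: j)
qed simp

section \<open>The lattice of level k, as multiples of a product of k factors 1 \<plusminus> i, and
  periods of the turns\<close>

fun scale :: "nat \<Rightarrow> nat \<Rightarrow> point \<Rightarrow> point" where
  "scale n 0 p = p"
| "scale n (Suc k) p = odot (\<alpha> n) (scale (Suc n) k p)"

lemma walk_start_dvd:
  assumes "walk s w" "toeplitz n s" "w 0 = (0, 0, 1)"
  shows "\<exists>p. start (w (2 ^ k * i)) = scale n k p"
  using assms
proof (induction k arbitrary: n s w)
  case (Suc k)
  note d = walk_derive[OF Suc.prems]
  obtain p where "start (up n (w (2 * (2 ^ k * i)))) = scale (Suc n) k p"
    using Suc.IH[OF d(1) toeplitz_even[OF Suc.prems(2)] d(2)] by auto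
  then have "start (w (2 ^ Suc k * i)) = scale n (Suc k) p"
    using arg_cong[OF d(3)[of "2 ^ k * i"], of start] by (simp add: mult.assoc)
  then show ?case by blast
qed auto

lemma odot_add: "odot c (p + q) = odot c p + odot c q"
  by (cases p; cases q) (auto simp: algebra_simps)

text \<open>The turn at a vertex other than 0 is decided after finitely many derivations, so
  translations from a sufficiently coarse lattice do not affect it.\<close>

lemma turn_periodic: "p \<noteq> (0, 0) \<Longrightarrow> \<exists>k\<ge>1. \<forall>q. turn n (p + scale n k q) = turn n p"
proof (induction n p rule: turn.induct)
  case (1 n p)
  show ?case
  proof (cases "even (fst p + snd p)")
    case False
    \<comment> \<open>Two factors 1 \<plusminus> i multiply to 2 or \<plusminus>2 i, so the
      translation keeps the parity of both coordinates.\<close>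
    have "turn n (p + scale n 2 q) = turn n p" for q
    proof -
      obtain r where r: "scale (Suc n) 1 q = r" "even (fst r + snd r)"
        using even_odot[OF \<alpha>] by (metis One_nat_def scale.simps)
      have "scale n 2 q = odot (\<alpha> n) r" using r(1) by (simp add: numeral_2_eq_2)
      moreover have "even (fst (odot (\<alpha> n) r) + snd (odot (\<alpha> n) r))" "even (snd (odot (\<alpha> n) r))"
        using r(2) \<alpha>[of n] by (cases r; auto)+
      ultimately show ?thesis
        using False by (auto simp: turn_odd sg_def)
    qed
    then show ?thesis by (intro exI[of _ 2]) auto
  next
    case True
    then obtain q where q: "p = odot (\<alpha> n) q" using even_point_odot[OF \<alpha>] by blast
    then obtain k where "\<forall>r. turn (Suc n) (q + scale (Suc n) k r) = turn (Suc n) q"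
      using 1 True \<alpha>[of n] by auto
    then have "\<forall>r. turn n (p + scale n (Suc k) r) = turn n p"
      unfolding q by (simp add: odot_add[symmetric])
    then show ?thesis by (intro exI[of _ "Suc k"]) auto
  qed
qed

end

subsection \<open>Classes of edges lying on the same curve\<close>

text \<open>In each case the translation vector is the position of a vertex deep inside the folding curve
  that replaces the edge \<open>(0, 0, 1)\<close>, found by inspection of these curves.\<close>

lemma par4_center:
  assumes "c0 = 1 \<or> c0 = -1" "c1 = 1 \<or> c1 = -1" "c2 = - c1" "c3 = 1 \<or> c3 = -1" "e \<in> center_arcs"
  shows "par c3 (par c2 (par c1 (par c0 (shift (if c3 = c2 then (1, c0)
    else (2 - c0 * c3, c3 + 2 * c0)) e)))) = (0, 0, 1)"
  using assms unfolding center_arcs_def insert_iff empty_iff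
  by (elim disjE FalseE) (simp_all add: par0.simps)

lemma par5_center_constant:
  assumes "c = 1 \<or> c = -1" "e \<in> center_arcs"
  shows "par c (par c (par c (par c (par c (shift (-3, - c) e))))) = (0, 0, 1)"
  using assms unfolding center_arcs_def insert_iff empty_iff
  by (elim disjE FalseE) (simp_all add: par0.simps)

lemma par5_square_alternating:
  assumes "c = 1 \<or> c = -1" "e \<in> square_arcs"
  shows "par c (par (- c) (par c (par (- c) (par c (shift (4, 2 * c) e))))) = (0, 0, 1)"
  using assms unfolding square_arcs_def center_arcs_def insert_iff empty_iff Un_iff
  by (elim disjE FalseE) (simp_all add: par0.simps)

context folding_plane begin

text \<open>Lying on one curve at level n, in either direction. It is defined through
  \<open>nxt\<close> alone, before any covering is considered.\<close>

inductive conn :: "nat \<Rightarrow> arc \<Rightarrow> arc \<Rightarrow> bool" for n where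
  conn_refl: "is_arc e \<Longrightarrow> conn n e e"
| conn_fwd: "conn n e f \<Longrightarrow> conn n e (nxt n f)"
| conn_bwd: "conn n e (nxt n f) \<Longrightarrow> is_arc f \<Longrightarrow> conn n e f"

lemma conn_arcs: "conn n e f \<Longrightarrow> is_arc e \<and> is_arc f"
  by (induction rule: conn.induct) auto

lemma conn_trans: "conn n f g \<Longrightarrow> conn n e f \<Longrightarrow> conn n e g"
  by (induction rule: conn.induct) (auto intro: conn.intros)

lemma conn_sym: "conn n e f \<Longrightarrow> conn n f e"
proof (induction rule: conn.induct)
  case (conn_fwd e f)
  then have "is_arc f" using conn_arcs by blast
  then have "conn n (nxt n f) f"
    by (intro conn.conn_bwd[OF conn.conn_refl[OF is_arc_nxt]])
  with conn_fwd.IH show ?case by (rule conn_trans)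
next
  case (conn_bwd e f)
  then have "conn n f (nxt n f)" by (intro conn.conn_fwd[OF conn.conn_refl])
  with conn_bwd.IH show ?case by (rule conn_trans)
qed (rule conn_refl)

text \<open>One step at level n + 1 becomes two steps at level n.\<close>

lemma conn_child0: "conn (Suc n) q r \<Longrightarrow> conn n (child0 (\<alpha> n) q) (child0 (\<alpha> n) r)"
proof (induction rule: conn.induct)
  case (conn_refl e)
  then show ?case by (simp add: conn.conn_refl \<alpha>)
next
  case (conn_fwd e f)
  then have "is_arc f" using conn_arcs by blast
  then show ?case
    using conn.conn_fwd[OF conn.conn_fwd[OF conn_fwd.IH]] by (simp add: nxt_child0 nxt_child1)
next
  case (conn_bwd e f)
  have "nxt n (nxt n (child0 (\<alpha> n) f)) = child0 (\<alpha> n) (nxt (Suc n) f)"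
    using conn_bwd.hyps by (simp add: nxt_child0 nxt_child1)
  then show ?case using conn_bwd by (metis \<alpha> conn.conn_bwd is_arc_child0 is_arc_nxt)
qed

lemma conn_child0_up:
  assumes "is_arc e"
  shows "conn n e (child0 (\<alpha> n) (up n e))"
  using assms
proof (cases rule: level_cases[of _ n])
  case 1
  with assms show ?thesis by (metis conn_refl)
next
  case 2
  with assms show ?thesis
    by (metis \<alpha> conn_bwd conn_refl is_arc_child0 is_arc_up nxt_child0)
qed

lemma conn_if_conn_up:
  assumes "conn (Suc n) (up n e) (up n f)" "is_arc e" "is_arc f"
  shows "conn n e f"
  using conn_child0[OF assms(1)] conn_child0_up[OF assms(2)] conn_child0_up[OF assms(3)]
  by (meson conn_sym conn_trans)

section \<open>Iterated parents and their fall into the square\<close>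

fun anc :: "nat \<Rightarrow> nat \<Rightarrow> arc \<Rightarrow> arc" where
  "anc n 0 e = e"
| "anc n (Suc k) e = anc (Suc n) k (up n e)"

lemma is_arc_anc [simp]: "is_arc e \<Longrightarrow> is_arc (anc n k e)"
  by (induction k arbitrary: n e) auto

lemma anc_add: "anc n (k + l) e = anc (n + k) l (anc n k e)"
  by (induction k arbitrary: n e) auto

lemma anc_Suc': "anc n (Suc k) e = up (n + k) (anc n k e)"
  using anc_add[of n k 1 e] by simp

lemma up_center [simp]: "e \<in> center_arcs \<Longrightarrow> up n e = e"
  by (simp add: up_def par_center \<alpha>)

lemma anc_center [simp]: "e \<in> center_arcs \<Longrightarrow> anc n k e = e"
  by (induction k arbitrary: n) auto

lemma square_is_arc: "e \<in> square_arcs \<Longrightarrow> is_arc e"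
  by (auto simp: square_arcs_def center_arcs_def)

lemma conn_if_conn_anc:
  "conn (n + k) (anc n k e) (anc n k f) \<Longrightarrow> is_arc e \<Longrightarrow> is_arc f \<Longrightarrow> conn n e f"
proof (induction k arbitrary: n e f)
  case (Suc k)
  have "conn (Suc n) (up n e) (up n f)"
    using Suc.IH[of "Suc n" "up n e" "up n f"] Suc.prems by simp
  with Suc.prems show ?case using conn_if_conn_up by blast
qed simp

lemma anc_surj: "is_arc f \<Longrightarrow> \<exists>e. is_arc e \<and> anc n k e = f"
proof (induction k arbitrary: n)
  case (Suc k)
  then obtain e where "is_arc e" "anc (Suc n) k e = f" by blast
  then show ?case by (intro exI[of _ "child0 (\<alpha> n) e"]) (simp add: \<alpha>)
next
  case 0
  then show ?case by (metis anc.simps(1))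
qed

lemma anc_square: "is_arc e \<Longrightarrow> \<exists>k. anc n k e \<in> square_arcs"
proof (induction "nat (size_arc e)" arbitrary: n e rule: less_induct)
  case less
  show ?case
  proof (cases "size_arc e \<le> 5")
    case True
    then have "anc n 0 e \<in> square_arcs" using square_arcs_if_size_le less.prems by simp
    then show ?thesis by blast
  next
    case False
    then have "size_arc (up n e) < size_arc e"
      using size_arc_par_less[OF \<alpha> less.prems] by (simp add: up_def)
    then obtain k where "anc (Suc n) k (up n e) \<in> square_arcs"
      using less.hyps[of "up n e" "Suc n"] less.prems False by auto
    then have "anc n (Suc k) e \<in> square_arcs" by simp
    then show ?thesis by blast
  qed
qed

lemma anc_square_stays: "e \<in> square_arcs \<Longrightarrow> anc n k e \<in> square_arcs"
  by (induction k arbitrary: n e) (auto simp: up_def par_square_arcs \<alpha>)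

lemma anc_square_mono:
  assumes "anc n k e \<in> square_arcs" "k \<le> l" shows "anc n l e \<in> square_arcs"
  using anc_square_stays[OF assms(1), of "n + k" "l - k"] anc_add[of n k "l - k" e] assms(2) by simp

text \<open>By the table, an edge that is not at 0 after one letter c lies on one of the four outer
  edges which c itself sends to 0.\<close>

lemma up_up_center:
  assumes "e \<in> square_arcs" "\<alpha> n = \<alpha> (Suc n)"
  shows "up (Suc n) (up n e) \<in> center_arcs"
  using assms(1) \<alpha>[of n] assms(2)
  by (auto simp: square_arcs_def up_def par_center par_square) (auto simp: center_arcs_def par0.simps)

lemma anc_center_if_repeated:
  assumes "anc n k e \<in> square_arcs" "n + k \<le> m" "\<alpha> m = \<alpha> (Suc m)" "m + 2 \<le> n + l"
  shows "anc n l e \<in> center_arcs"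
proof -
  have "anc n (m - n) e \<in> square_arcs" using assms by (auto intro: anc_square_mono[OF assms(1)])
  then have "anc m 2 (anc n (m - n) e) \<in> center_arcs"
    using up_up_center[OF _ assms(3)] by (simp add: numeral_2_eq_2)
  then have "anc n (m - n + 2) e \<in> center_arcs"
    unfolding anc_add[of n "m - n" 2] using assms(2) by simp
  then have "anc n (m - n + 2 + (l - (m - n + 2))) e \<in> center_arcs"
    unfolding anc_add[of n "m - n + 2"] by simp
  moreover have "m - n + 2 + (l - (m - n + 2)) = l" using assms by linarith
  ultimately show ?thesis by metis
qed

text \<open>The edges entering 0 are \<open>(0, 1, -1)\<close> and \<open>(0, -1, 1)\<close>; the
  turn \<epsilon> joins them to \<open>(0, 0, \<epsilon>)\<close> and
  \<open>(0, 0, - \<epsilon>)\<close>.\<close>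

lemma conn_center:
  assumes "e \<in> center_arcs"
  shows "conn n e (0, 0, 1) \<or> conn n e (0, 0, -1)"
proof -
  have arc: "is_arc (0, 1, -1)" "is_arc (0, -1, 1)" "is_arc (0, 0, 1)" "is_arc (0, 0, -1)" by auto
  have "conn n (0, 1, -1) (0, 0, \<epsilon>)" "conn n (0, -1, 1) (0, 0, - \<epsilon>)"
    using conn_fwd[OF conn_refl[OF arc(1)], of n] conn_fwd[OF conn_refl[OF arc(2)], of n]
    by (simp_all add: nxt_def)
  then show ?thesis
    using assms \<epsilon> conn_refl[OF arc(3), of n] conn_refl[OF arc(4), of n] by (auto simp: center_arcs_def)
qed

lemma conn_if_anc_center:
  assumes "is_arc e" "anc n k e \<in> center_arcs"
  shows "conn n e (0, 0, 1) \<or> conn n e (0, 0, -1)"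
proof -
  have "(0, 0, 1) \<in> center_arcs" "(0, 0, -1) \<in> center_arcs" by (auto simp: center_arcs_def)
  then have "anc n k (0, 0, 1) = (0, 0, 1)" "anc n k (0, 0, -1) = (0, 0, -1)" by simp_all
  with conn_center[OF assms(2), of "n + k"] show ?thesis
    using assms conn_if_conn_anc[of n k e "(0, 0, 1)"] conn_if_conn_anc[of n k e "(0, 0, -1)"]
    by auto
qed

text \<open>Consecutive edges acquire a common ancestor unless they meet at 0, because any other common
  vertex disappears in some derivative.\<close>

lemma nxt_invariant:
  assumes G: "\<And>m e. e \<in> G m \<Longrightarrow> up m e \<in> G (Suc m)"
    and center: "\<And>m. (0, 1, -1) \<in> G m \<longleftrightarrow> (0, 0, \<epsilon>) \<in> G m" "\<And>m. (0, -1, 1) \<in> G m \<longleftrightarrow> (0, 0, - \<epsilon>) \<in> G m"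
    and "is_arc e"
  shows "(\<exists>k. anc n k e \<in> G (n + k)) \<longleftrightarrow> (\<exists>k. anc n k (nxt n e) \<in> G (n + k))"
  using \<open>is_arc e\<close>
proof (induction "nat (sqnorm (head e))" arbitrary: e n rule: less_induct)
  case less
  \<comment> \<open>Asking for some k makes the property independent of the level at which it is
    read.\<close>
  have lift: "(\<exists>k. anc n k f \<in> G (n + k)) \<longleftrightarrow> (\<exists>k. anc (Suc n) k (up n f) \<in> G (Suc n + k))" for f
  proof
    assume "\<exists>k. anc n k f \<in> G (n + k)"
    then obtain k where "anc n k f \<in> G (n + k)" by blast
    then have "anc n (Suc k) f \<in> G (n + Suc k)" unfolding anc_Suc' using G by simp
    then show "\<exists>k. anc (Suc n) k (up n f) \<in> G (Suc n + k)" by (intro exI[of _ k]) simp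
  next
    assume "\<exists>k. anc (Suc n) k (up n f) \<in> G (Suc n + k)"
    then obtain k where "anc (Suc n) k (up n f) \<in> G (Suc n + k)" by blast
    then have "anc n (Suc k) f \<in> G (n + Suc k)" by simp
    then show "\<exists>k. anc n k f \<in> G (n + k)" by blast
  qed
  show ?case
  proof (cases "even (fst (head e) + snd (head e))")
    case False
    then show ?thesis using lift[of e] lift[of "nxt n e"] up_nxt(1)[OF less.prems] by simp
  next
    case True
    note u = up_nxt(2)[OF less.prems True, of n]
    show ?thesis
    proof (cases "head e = (0, 0)")
      case False
      then have "nat (sqnorm (head (up n e))) < nat (sqnorm (head e))"
        using u sqnorm_odot[OF \<alpha>[of n], of "head (up n e)"] sqnorm_pos[of "head e"] by auto
      then show ?thesis
        using less.hyps[of "up n e" "Suc n"] less.prems lift[of e] lift[of "nxt n e"] u by simp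
    next
      case True
      obtain x y d where xyd: "e = (x, y, d)" by (cases e)
      have "e = (0, 1, -1) \<or> e = (0, -1, 1)"
        using True less.prems by (cases "even (x + y)") (auto simp: xyd add_eq_0_iff)
      moreover have "(0, 1, -1) \<in> center_arcs" "(0, -1, 1) \<in> center_arcs" "(0, 0, \<epsilon>) \<in> center_arcs"
          "(0, 0, -\<epsilon>) \<in> center_arcs"
        using \<epsilon> by (auto simp: center_arcs_def)
      ultimately show ?thesis using center by (auto simp: nxt_def)
    qed
  qed
qed

text \<open>The tool for separating classes: such a family yields a property constant along each
  curve, so edges on which it differs are not connected.\<close>

lemma conn_invariant:
  assumes "conn n e f"
    and "\<And>m e. e \<in> G m \<Longrightarrow> up m e \<in> G (Suc m)"
    and "\<And>m. (0, 1, -1) \<in> G m \<longleftrightarrow> (0, 0, \<epsilon>) \<in> G m" "\<And>m. (0, -1, 1) \<in> G m \<longleftrightarrow> (0, 0, - \<epsilon>) \<in> G m"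
  shows "(\<exists>k. anc n k e \<in> G (n + k)) \<longleftrightarrow> (\<exists>k. anc n k f \<in> G (n + k))"
  using assms(1)
proof (induction rule: conn.induct)
  case (conn_fwd e f)
  then show ?case using nxt_invariant[of G f n, OF assms(2-4)] conn_arcs by blast
next
  case (conn_bwd e f)
  then show ?case using nxt_invariant[of G f n, OF assms(2-4)] by blast
qed simp

lemma not_conn_center: "\<not> conn n (0, 0, 1) (0, 0, -1)"
proof
  assume conn: "conn n (0, 0, 1) (0, 0, -1)"
  \<comment> \<open>One of the two pairs joined at 0; it contains exactly one of the two edges in
    question.\<close>
  define G :: "nat \<Rightarrow> arc set" where "G m = {(0, 0, \<epsilon>), (0, 1, -1)}" for m
  have c: "(0, 0, 1) \<in> center_arcs" "(0, 0, -1) \<in> center_arcs" "\<And>m. G m \<subseteq> center_arcs"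
    using \<epsilon> by (auto simp: center_arcs_def G_def)
  have "up m e \<in> G (Suc m)" if "e \<in> G m" for m e
    using that c(3)[of m] by (auto simp: G_def)
  then have "(\<exists>k. anc n k (0, 0, 1) \<in> G (n + k)) \<longleftrightarrow> (\<exists>k. anc n k (0, 0, -1) \<in> G (n + k))"
    using \<epsilon> by (intro conn_invariant[OF conn]) (auto simp: G_def)
  then show False using c \<epsilon> by (auto simp: G_def)
qed

lemma conn_center_if_not_alternating:
  assumes "\<And>N. \<exists>m\<ge>N. \<alpha> m = \<alpha> (Suc m)" "is_arc e"
  shows "conn n e (0, 0, 1) \<or> conn n e (0, 0, -1)"
proof -
  obtain k where k: "anc n k e \<in> square_arcs" using anc_square[OF assms(2)] by blast
  obtain m where m: "m \<ge> n + k" "\<alpha> m = \<alpha> (Suc m)" using assms(1) by blast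
  have "anc n (m + 2) e \<in> center_arcs" by (rule anc_center_if_repeated[OF k m]) simp
  then show ?thesis by (rule conn_if_anc_center[OF assms(2)])
qed

text \<open>The edges of the square whose ancestors never reach 0 when the letters from \<open>c\<close> on alternate.\<close>

definition survivors :: "int \<Rightarrow> arc list" where
  "survivors c = (if c = 1 then [(1, 1, -1), (1, 0, -1), (-1, -1, 1), (-1, 0, 1)]
     else [(1, 0, 1), (1, -1, -1), (-1, 0, -1), (-1, 1, 1)])"

lemma survivors_props:
  assumes "c = 1 \<or> c = -1"
  shows "distinct (survivors c)" "set (survivors c) \<subseteq> square_arcs - center_arcs" "length (survivors c) = 4"
    "i < 4 \<Longrightarrow> par c (survivors c ! i) = survivors (- c) ! i"
    "e \<in> square_arcs \<Longrightarrow> e \<in> set (survivors c) \<or> par c e \<in> center_arcs"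
proof -
  show "distinct (survivors c)" "length (survivors c) = 4" by (simp_all add: survivors_def)
  show "set (survivors c) \<subseteq> square_arcs - center_arcs"
    by (auto simp: survivors_def square_arcs_def center_arcs_def)
  show "par c (survivors c ! i) = survivors (- c) ! i" if "i < 4"
  proof -
    have "i = 0 \<or> i = 1 \<or> i = 2 \<or> i = 3" using that by linarith
    then show ?thesis using assms
      by (elim disjE) (simp_all add: survivors_def par_square numeral_2_eq_2 numeral_3_eq_3 del: par.simps)
  qed
  show "e \<in> set (survivors c) \<or> par c e \<in> center_arcs" if "e \<in> square_arcs"
    using that assms unfolding square_arcs_def center_arcs_def Un_iff insert_iff empty_iff
    by (elim disjE FalseE) (simp_all add: survivors_def par0.simps)
qed

lemma alternating_representatives:
  assumes alt: "\<And>m. m \<ge> N \<Longrightarrow> \<alpha> (Suc m) = - \<alpha> m"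
  obtains r where "\<And>i. i < 4 \<Longrightarrow> is_arc (r i)"
    "\<And>i. i < 4 \<Longrightarrow> \<not> conn 0 (r i) (0, 0, 1) \<and> \<not> conn 0 (r i) (0, 0, -1)"
    "\<And>i j. i < 4 \<Longrightarrow> j < (4::nat) \<Longrightarrow> conn 0 (r i) (r j) \<Longrightarrow> i = j"
    "\<And>e. is_arc e \<Longrightarrow> conn 0 e (0, 0, 1) \<or> conn 0 e (0, 0, -1) \<or> (\<exists>i<4. conn 0 e (r i))"
proof -
  define S where "S m i = survivors (\<alpha> m) ! i" for m i
  note sp = survivors_props[OF \<alpha>]
  have S: "S m i \<in> square_arcs" "S m i \<notin> center_arcs" if "i < 4" for m i
  proof -
    have "S m i \<in> set (survivors (\<alpha> m))" using sp(3)[of m] that by (simp add: S_def)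
    then show "S m i \<in> square_arcs" "S m i \<notin> center_arcs" using sp(2)[of m] by auto
  qed
  have S_inj: "S m i = S m j \<longleftrightarrow> i = j" if "i < 4" "j < 4" for m i j
    unfolding S_def using sp(1,3)[of m] that by (simp add: nth_eq_iff_index_eq)
  have up_S: "up m (S m i) = S (Suc m) i" if "m \<ge> N" "i < 4" for m i
    using sp(4)[OF that(2)] alt[OF that(1)] by (simp add: up_def S_def)
  \<comment> \<open>Survivors are pulled back to level 0 through the first N levels, where the
    letters are arbitrary.\<close>
  have "\<exists>e. is_arc e \<and> anc 0 N e = S N i" if "i < 4" for i
    using anc_surj square_is_arc S that by blast
  then obtain r where r: "\<And>i. i < 4 \<Longrightarrow> is_arc (r i) \<and> anc 0 N (r i) = S N i" by metis
  have anc_r: "anc 0 k (r i) = S k i" if "k \<ge> N" "i < 4" for k i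
    using that(1)
  proof (induction k rule: dec_induct)
    case (step k)
    then show ?case using up_S[OF _ that(2), of k] by (simp only: anc_Suc') simp
  qed (use r that in simp)
  \<comment> \<open>A single survivor is carried to the survivor with the same number only from
    level N on; the empty set before N keeps the family closed under parents.\<close>
  define G where "G i m = (if m \<ge> N then {S m i} else {})" for i m
  have inv: "(\<exists>k. anc 0 k e \<in> G i (0 + k)) \<longleftrightarrow> (\<exists>k. anc 0 k f \<in> G i (0 + k))" if "conn 0 e f" "i < 4" for e f i
  proof (rule conn_invariant[OF that(1)])
    have c: "{(0, 1, -1), (0, -1, 1), (0, 0, \<epsilon>), (0, 0, -\<epsilon>)} \<subseteq> center_arcs"
      using \<epsilon> by (auto simp: center_arcs_def)
    have nc: "G i m \<inter> center_arcs = {}" for m using S[OF that(2)] by (auto simp: G_def)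
    show "((0, 1, -1) \<in> G i m) = ((0, 0, \<epsilon>) \<in> G i m)"
      "((0, -1, 1) \<in> G i m) = ((0, 0, - \<epsilon>) \<in> G i m)" for m using c nc[of m] by auto
    show "up m e \<in> G i (Suc m)" if "e \<in> G i m" for m e
      using that up_S[OF _ \<open>i < 4\<close>, of m] by (auto simp: G_def split: if_splits)
  qed
  have G_r: "(\<exists>k. anc 0 k (r j) \<in> G i (0 + k)) \<longleftrightarrow> i = j" if "i < 4" "j < 4" for i j
  proof
    assume "\<exists>k. anc 0 k (r j) \<in> G i (0 + k)"
    then show "i = j" using anc_r that S_inj by (auto simp: G_def split: if_splits)
  next
    assume "i = j"
    then have "anc 0 N (r j) \<in> G i (0 + N)" using r that by (simp add: G_def)
    then show "\<exists>k. anc 0 k (r j) \<in> G i (0 + k)" by blast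
  qed
  have G_center: "\<not> (\<exists>k. anc 0 k e \<in> G i (0 + k))" if "e \<in> center_arcs" "i < 4" for e i
    using that S[OF that(2)] by (auto simp: G_def)
  have c: "(0, 0, 1) \<in> center_arcs" "(0, 0, -1) \<in> center_arcs" by (auto simp: center_arcs_def)
  show ?thesis
  proof (rule that[of r])
    show "is_arc (r i)" if "i < 4" for i using r that by blast
    show "\<not> conn 0 (r i) (0, 0, 1) \<and> \<not> conn 0 (r i) (0, 0, -1)" if "i < 4" for i
      using inv[OF _ that] G_r[OF that that] G_center[OF c(1) that] G_center[OF c(2) that] by blast
    show "i = j" if "i < 4" "j < 4" "conn 0 (r i) (r j)" for i j
      using inv[OF that(3,1)] G_r[OF that(1,1)] G_r[OF that(1,2)] by blast
    show "conn 0 e (0, 0, 1) \<or> conn 0 e (0, 0, -1) \<or> (\<exists>i<4. conn 0 e (r i))" if arc: "is_arc e" for e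
    proof -
      obtain k where "anc 0 k e \<in> square_arcs" using anc_square[OF arc] by blast
      then have sq: "anc 0 (max k N) e \<in> square_arcs" by (rule anc_square_mono) simp
      from sp(5)[OF sq, of "max k N"] show ?thesis
      proof
        assume "anc 0 (max k N) e \<in> set (survivors (\<alpha> (max k N)))"
        then obtain i where i: "i < 4" "anc 0 (max k N) e = S (max k N) i"
          using sp(3) by (auto simp: in_set_conv_nth S_def)
        then have "anc 0 (max k N) e = anc 0 (max k N) (r i)" using anc_r by simp
        then have "conn 0 e (r i)"
          using conn_if_conn_anc[of 0 "max k N" e "r i"] arc r i by (simp add: conn_refl)
        with i show ?thesis by blast
      next
        assume "par (\<alpha> (max k N)) (anc 0 (max k N) e) \<in> center_arcs"
        then have "anc 0 (Suc (max k N)) e \<in> center_arcs" by (simp only: anc_Suc') (simp add: up_def)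
        then show ?thesis using conn_if_anc_center[OF arc] by blast
      qed
    qed
  qed
qed

section \<open>Vertices deep inside a single curve\<close>

lemma even_scale: "even (fst v + snd v) \<Longrightarrow> even (fst (scale n k v) + snd (scale n k v))"
  by (cases k) (auto simp: even_odot[OF \<alpha>, simplified])

lemma anc_shift:
  assumes "is_arc e" "even (fst v + snd v)"
  shows "anc n k (shift (scale n k v) e) = shift v (anc n k e)"
  using assms
proof (induction k arbitrary: n e)
  case (Suc k)
  have "up n (shift (scale n (Suc k) v) e) = shift (scale (Suc n) k v) (up n e)"
    using par_shift[OF \<alpha> Suc.prems(1) even_scale[OF Suc.prems(2), of "Suc n" k], of n] by (simp add: up_def)
  with Suc show ?case by simp
qed simp

text \<open>All four edges at the translated vertex descend from \<open>(0, 0, 1)\<close>: both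
  strands through that vertex belong to the same curve, unlike those at 0.\<close>

lemma shift_center_merge:
  assumes "\<alpha> (n + 2) \<noteq> \<alpha> (n + 1)" "e \<in> center_arcs"
  shows "anc n 4 (shift (if \<alpha> (n + 3) = \<alpha> (n + 2) then (1, \<alpha> n)
    else (2 - \<alpha> n * \<alpha> (n + 3), \<alpha> (n + 3) + 2 * \<alpha> n)) e) = (0, 0, 1)"
proof -
  have 4: "anc n 4 f = par (\<alpha> (n + 3)) (par (\<alpha> (n + 2)) (par (\<alpha> (n + 1)) (par (\<alpha> n) f)))" for f
    by (simp add: numeral_eq_Suc up_def)
  show ?thesis
    unfolding 4 using \<alpha>[of "n + 1"] \<alpha>[of "n + 2"] assms by (intro par4_center \<alpha>) auto
qed

lemma shift_center_merge_const:
  assumes "\<And>i. i < 5 \<Longrightarrow> \<alpha> (n + i) = c" "e \<in> center_arcs"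
  shows "anc n 5 (shift (-3, - c) e) = (0, 0, 1)"
proof -
  have "anc n 5 f = par (\<alpha> (n + 4)) (par (\<alpha> (n + 3)) (par (\<alpha> (n + 2)) (par (\<alpha> (n + 1)) (par (\<alpha> (n + 0)) f))))" for f
    by (simp add: numeral_eq_Suc up_def)
  then have 5: "anc n 5 f = par c (par c (par c (par c (par c f))))" for f
    using assms(1)[of 0] assms(1)[of 1] assms(1)[of 2] assms(1)[of 3] assms(1)[of 4]
    by (simp only: numeral_less_iff zero_less_numeral one_less_numeral_iff semiring_norm)
  have "c = 1 \<or> c = -1" using assms(1)[of 0] \<alpha>[of n] by auto
  then show ?thesis
    unfolding 5 using assms(2) by (rule par5_center_constant)
qed

text \<open>When the letters alternate, four outer edges never reach the centre, so all twelve edges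
  of the square have to be merged at once.\<close>

lemma shift_square_merge:
  assumes "\<And>i. i < 4 \<Longrightarrow> \<alpha> (Suc (n + i)) = - \<alpha> (n + i)" "e \<in> square_arcs"
  shows "anc n 5 (shift (4, 2 * \<alpha> n) e) = (0, 0, 1)"
proof -
  have "anc n 5 f = par (\<alpha> (n + 4)) (par (\<alpha> (n + 3)) (par (\<alpha> (n + 2)) (par (\<alpha> (n + 1)) (par (\<alpha> (n + 0)) f))))" for f
    by (simp add: numeral_eq_Suc up_def)
  moreover have "\<alpha> (n + 1) = - \<alpha> n" "\<alpha> (n + 2) = \<alpha> n" "\<alpha> (n + 3) = - \<alpha> n" "\<alpha> (n + 4) = \<alpha> n"
    using assms(1)[of 0] assms(1)[of 1] assms(1)[of 2] assms(1)[of 3] by (simp_all add: numeral_eq_Suc)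
  ultimately have 5: "anc n 5 f = par (\<alpha> n) (par (- \<alpha> n) (par (\<alpha> n) (par (- \<alpha> n) (par (\<alpha> n) f))))" for f
    by simp
  show ?thesis
    unfolding 5 using \<alpha> assms(2) by (rule par5_square_alternating)
qed

text \<open>A bounded set of edges shrinks under repeated derivation to edges of the square, around 0 as
  well as around any translate by a vertex of the coarse lattice.\<close>

lemma conn_big_box:
  obtains V where "\<And>x y d. is_arc (x, y, d) \<Longrightarrow> \<bar>x\<bar> \<le> \<rho> \<Longrightarrow> \<bar>y\<bar> \<le> \<rho> \<Longrightarrow>
    conn 0 (shift V (x, y, d)) (0, 0, 1)"
proof -
  define B where "B = {e. is_arc e \<and> \<bar>fst e\<bar> \<le> \<rho> \<and> \<bar>fst (snd e)\<bar> \<le> \<rho>}"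
  have "B \<subseteq> {-\<rho>..\<rho>} \<times> {-\<rho>..\<rho>} \<times> {1, -1}" by (auto simp: B_def)
  then have fin: "finite B" by (rule finite_subset) auto
  have "\<exists>K. \<forall>e\<in>B. anc 0 K e \<in> square_arcs"
  proof -
    obtain f where f: "\<And>e. is_arc e \<Longrightarrow> anc 0 (f e) e \<in> square_arcs" using anc_square[of _ 0] by metis
    have "anc 0 (Max (insert 0 (f ` B))) e \<in> square_arcs" if "e \<in> B" for e
    proof (rule anc_square_mono[OF f])
      show "is_arc e" using that by (simp add: B_def)
      show "f e \<le> Max (insert 0 (f ` B))" using fin that by (intro Max_ge) auto
    qed
    then show ?thesis by blast
  qed
  then obtain K where K: "\<And>e. e \<in> B \<Longrightarrow> anc 0 K e \<in> square_arcs" by blast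
  \<comment> \<open>Without a repeated letter from K on, the letters alternate. Otherwise a
    repetition drives all ancestors to the centre, after which either a later change of letter or a
    constant tail supplies the translation.\<close>
  have "\<exists>n k v. even (fst v + snd v) \<and> (\<forall>e\<in>B. anc n k (shift v (anc 0 n e)) = (0, 0, 1))"
  proof (cases "\<exists>m\<ge>K. \<alpha> m = \<alpha> (Suc m)")
    case False
    then have "\<alpha> (Suc (K + i)) = - \<alpha> (K + i)" for i
      using \<alpha>[of "K + i"] \<alpha>[of "Suc (K + i)"] by (metis le_add1 minus_minus)
    then have "\<forall>e\<in>B. anc K 5 (shift (4, 2 * \<alpha> K) (anc 0 K e)) = (0, 0, 1)"
      using shift_square_merge K by simp
    moreover have "even (fst (4::int, 2 * \<alpha> K) + snd (4::int, 2 * \<alpha> K))" by simp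
    ultimately show ?thesis by blast
  next
    case True
    then obtain m where m: "m \<ge> K" "\<alpha> m = \<alpha> (Suc m)" by blast
    have center: "anc 0 l e \<in> center_arcs" if "e \<in> B" "l \<ge> m + 2" for e l
      using anc_center_if_repeated[OF K[OF that(1)] _ m(2)] m(1) that(2) by simp
    show ?thesis
    proof (cases "\<exists>n\<ge>m + 2. \<alpha> (n + 2) \<noteq> \<alpha> (n + 1)")
      case True
      then obtain n where n: "n \<ge> m + 2" "\<alpha> (n + 2) \<noteq> \<alpha> (n + 1)" by blast
      define v where "v = (if \<alpha> (n + 3) = \<alpha> (n + 2) then (1, \<alpha> n)
        else (2 - \<alpha> n * \<alpha> (n + 3), \<alpha> (n + 3) + 2 * \<alpha> n))"
      have "even (fst v + snd v)"
        using \<alpha>[of n] \<alpha>[of "n + 3"] by (auto simp: v_def)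
      moreover have "\<forall>e\<in>B. anc n 4 (shift v (anc 0 n e)) = (0, 0, 1)"
        using shift_center_merge[OF n(2)] center n(1) unfolding v_def by blast
      ultimately show ?thesis by blast
    next
      case False
      then have eq: "\<alpha> (m + 3 + Suc i) = \<alpha> (m + 3 + i)" for i
        by (auto dest: spec[of _ "m + 2 + i"] simp: numeral_eq_Suc)
      have const: "\<alpha> (m + 3 + i) = \<alpha> (m + 3)" for i
        by (induction i) (use eq in auto)
      have "\<forall>e\<in>B. anc (m + 3) 5 (shift (-3, - \<alpha> (m + 3)) (anc 0 (m + 3) e)) = (0, 0, 1)"
        using shift_center_merge_const[of "m + 3", OF const] center by simp
      moreover have "even (fst (-3::int, - \<alpha> (m + 3)) + snd (-3::int, - \<alpha> (m + 3)))"
        using \<alpha>[of "m + 3"] by auto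
      ultimately show ?thesis by blast
    qed
  qed
  then obtain n k v where v: "even (fst v + snd v)"
    and merge: "\<And>e. e \<in> B \<Longrightarrow> anc n k (shift v (anc 0 n e)) = (0, 0, 1)" by blast
  show ?thesis
  \<comment> \<open>A translation by v at level n is a translation by \<open>scale 0 n v\<close> at
    level 0.\<close>
  proof (rule that[of "scale 0 n v"])
    fix x y d assume *: "is_arc (x, y, d)" "\<bar>x\<bar> \<le> \<rho>" "\<bar>y\<bar> \<le> \<rho>"
    let ?f = "shift (scale 0 n v) (x, y, d)"
    have c: "(0, 0, 1) \<in> center_arcs" by (simp add: center_arcs_def)
    have "anc 0 (n + k) ?f = (0, 0, 1)"
      unfolding anc_add using merge[of "(x, y, d)"] * anc_shift[OF *(1) v, of 0 n] by (simp add: B_def)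
    moreover have "is_arc ?f" using *(1) by (cases "scale 0 n v") auto
    ultimately show "conn 0 ?f (0, 0, 1)"
      using conn_if_conn_anc[of 0 "n + k" ?f "(0, 0, 1)"] c by (simp add: conn_refl)
  qed
qed

end

subsection \<open>Folding sequences\<close>

lemma folding_length: "folding n S \<Longrightarrow> length S = 2 ^ n - 1"
proof (induction rule: folding.induct)
  case (folding_Suc n S e)
  then show ?case using one_le_power[of "2::nat" n] by (simp add: bar_def)
qed simp

lemma folding_values: "folding n S \<Longrightarrow> set S \<subseteq> {1, -1}"
  by (induction rule: folding.induct) (auto simp: bar_def)

lemma infinite_folding_seq_values:
  assumes "infinite_folding_seq a" "h \<ge> 1"
  shows "a h = 1 \<or> a h = -1"
proof -
  have "folding h (map a [1..<2 ^ h])" using assms by (simp add: infinite_folding_seq_def)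
  moreover have "h < 2 ^ h" by (rule less_exp)
  ultimately show ?thesis using folding_values assms(2) by fastforce
qed

text \<open>Index 2 ^ n is the middle of the prefix of length 2 ^ (n + 1) - 1, whose first half is
  the negated reversal of the second.\<close>

lemma infinite_folding_seq_reflect:
  assumes "infinite_folding_seq a" "0 < j" "j < 2 ^ n"
  shows "a (2 ^ n + j) = - a (2 ^ n - j)"
proof -
  have "folding (Suc n) (map a [1..<2 ^ Suc n])"
    using assms(1) by (simp add: infinite_folding_seq_def del: power_Suc)
  then obtain S e where S: "folding n S" "map a [1..<2 ^ Suc n] = bar S @ [e] @ S"
    by (cases rule: folding.cases) auto
  have len: "length S = 2 ^ n - 1" using folding_length[OF S(1)] .
  have nth: "a (Suc i) = (bar S @ [e] @ S) ! i" if "Suc i < 2 ^ Suc n" for i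
    using that arg_cong[OF S(2), of "\<lambda>l. l ! i"] by simp
  have "2 ^ n + j = Suc (length (bar S) + j)" using len assms(2,3) by (simp add: bar_def)
  then have "a (2 ^ n + j) = ([e] @ S) ! j"
    using nth[of "length (bar S) + j"] assms(3) by (simp del: append.simps add: nth_append_length_plus)
  then have "a (2 ^ n + j) = S ! (j - 1)" using assms(2) by (simp add: nth_Cons')
  moreover have "a (2 ^ n - j) = - (S ! (j - 1))"
  proof -
    define i where "i = 2 ^ n - j - 1"
    have i: "Suc i = 2 ^ n - j" "i < length S" "length S - Suc i = j - 1"
      using assms(2,3) len by (auto simp: i_def)
    have "a (Suc i) = bar S ! i" using nth[of i] i by (simp add: nth_append bar_def)
    also have "\<dots> = - (S ! (j - 1))" using i by (simp add: bar_def rev_nth)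
    finally show ?thesis using i(1) by simp
  qed
  ultimately show ?thesis by simp
qed

text \<open>For k > 0 let 2 ^ N be the largest power of 2 below 2 k + 1. Reflection in 2 ^ (m + N)
  replaces k by 2 ^ N - k - 1, which is smaller and, since N > 0, of the other parity; so both sides
  change sign.\<close>

lemma infinite_folding_seq_toeplitz:
  assumes "infinite_folding_seq a"
  shows "a (2 ^ m * (2 * k + 1)) = sg (int k) * a (2 ^ m)"
proof (induction k rule: less_induct)
  case (less k)
  show ?case
  proof (cases "k = 0")
    case False
    obtain N where N: "2 ^ N \<le> 2 * k + 1" "2 * k + 1 < 2 ^ Suc N"
      using ex_power_ivl1[of 2 "2 * k + 1"] by auto
    have "N \<noteq> 0" using N False by (cases N) auto
    then obtain M where M: "N = Suc M" by (cases N) auto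
    define k' where "k' = 2 ^ N - k - 1"
    have "2 ^ M \<le> k" "k < 2 * 2 ^ M" using N unfolding M by auto
    then have k': "k' < k" "k' + k + 1 = 2 ^ N" unfolding k'_def M using False by auto
    have "2 * k + 1 = 2 ^ N + (k - k')" "2 * k' + 1 = 2 ^ N - (k - k')" using k' by linarith+
    then have "2 ^ m * (2 * k + 1) = 2 ^ (m + N) + 2 ^ m * (k - k')"
      "2 ^ m * (2 * k' + 1) = 2 ^ (m + N) - 2 ^ m * (k - k')"
      by (simp_all only: power_add distrib_left diff_mult_distrib2)
    moreover have "0 < 2 ^ m * (k - k')" "2 ^ m * (k - k') < 2 ^ (m + N)"
      using k' by (auto simp: power_add)
    ultimately have "a (2 ^ m * (2 * k + 1)) = - a (2 ^ m * (2 * k' + 1))"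
      using infinite_folding_seq_reflect[OF assms] by metis
    moreover have "even k' \<longleftrightarrow> odd k" using k'(2) M by (metis dvd_triv_left even_add even_plus_one_iff power_Suc)
    ultimately show ?thesis using less.IH[OF k'(1)] by (auto simp: sg_def)
  qed simp
qed

lemma toeplitz_two_sided:
  assumes "infinite_folding_seq a" "\<epsilon> = 1 \<or> \<epsilon> = -1"
  shows "folding_plane (\<lambda>n. a (2 ^ n)) \<epsilon>" "folding_plane.toeplitz (\<lambda>n. a (2 ^ n)) \<epsilon> 0 (two_sided a \<epsilon>)"
proof -
  interpret folding_plane "\<lambda>n. a (2 ^ n)" \<epsilon>
    using infinite_folding_seq_values[OF assms(1)] assms(2) by unfold_locales auto
  show "folding_plane (\<lambda>n. a (2 ^ n)) \<epsilon>" by unfold_locales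
  have pos: "two_sided a \<epsilon> (2 ^ m * (2 * int k + 1)) = sg (int k) * a (2 ^ m)"
    and neg: "two_sided a \<epsilon> (- (2 ^ m * (2 * int k + 1))) = - (sg (int k) * a (2 ^ m))" for m k
  proof -
    have *: "2 ^ m * (2 * int k + 1) = int (2 ^ m * (2 * k + 1))" by (simp add: algebra_simps)
    show "two_sided a \<epsilon> (2 ^ m * (2 * int k + 1)) = sg (int k) * a (2 ^ m)"
      "two_sided a \<epsilon> (- (2 ^ m * (2 * int k + 1))) = - (sg (int k) * a (2 ^ m))"
      unfolding * two_sided_def using infinite_folding_seq_toeplitz[OF assms(1), of m k] 
      by (simp_all del: of_nat_mult of_nat_power of_nat_add)
  qed
  have "two_sided a \<epsilon> (2 ^ m * (2 * k + 1)) = sg k * a (2 ^ m)" for m k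
  proof (cases "k \<ge> 0")
    case True
    then show ?thesis using pos[of m "nat k"] by simp
  next
    case False
    define l where "l = nat (- k - 1)"
    have k: "k = - int l - 1" using False by (simp add: l_def)
    have "2 ^ m * (2 * k + 1) = - (2 ^ m * (2 * int l + 1))" by (simp add: k algebra_simps)
    moreover have "sg k = - sg (int l)" by (simp add: k sg_def)
    ultimately show ?thesis using neg[of m l] by simp
  qed
  then show "toeplitz 0 (two_sided a \<epsilon>)" by (simp add: toeplitz_def) (simp add: two_sided_def)
qed

text \<open>Agreement with \<open>(-1) ^ n\<close> keeps its truth value from n to n + 1 exactly if
  the letter changes sign.\<close>

lemma eventually_alternating_iff:
  fixes \<alpha> :: "nat \<Rightarrow> int"
  assumes "\<And>n. \<alpha> n = 1 \<or> \<alpha> n = -1"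
  shows "finite {n. \<alpha> n = (-1) ^ n} \<or> finite (- {n. \<alpha> n = (-1) ^ n}) \<longleftrightarrow>
    (\<exists>N. \<forall>m\<ge>N. \<alpha> (Suc m) = - \<alpha> m)" (is "?L \<longleftrightarrow> ?R")
proof
  assume ?L
  then obtain N where N: "(\<forall>n\<ge>N. \<alpha> n \<noteq> (-1) ^ n) \<or> (\<forall>n\<ge>N. \<alpha> n = (-1) ^ n)"
    unfolding finite_nat_set_iff_bounded by (auto simp: not_less[symmetric])
  have pm: "(-1) ^ n = (1::int) \<or> (-1) ^ n = (-1::int)" for n :: nat
    by (cases "even n") auto
  have "\<alpha> (Suc m) = - \<alpha> m" if "m \<ge> N" for m
  proof -
    have "(\<alpha> m = (-1) ^ m) = (\<alpha> (Suc m) = (-1) ^ Suc m)"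
      using N that le_SucI by blast
    then show ?thesis using assms[of m] assms[of "Suc m"] pm[of m] by auto
  qed
  then show ?R by blast
next
  assume ?R
  then obtain N where N: "\<And>m. m \<ge> N \<Longrightarrow> \<alpha> (Suc m) = - \<alpha> m" by blast
  have "(\<alpha> n = (-1) ^ n) = (\<alpha> N = (-1) ^ N)" if "n \<ge> N" for n
    using that by (induction n rule: dec_induct) (auto simp: N)
  then have "{n. \<alpha> n = (-1) ^ n} \<subseteq> {..<N} \<or> - {n. \<alpha> n = (-1) ^ n} \<subseteq> {..<N}"
    by (metis (mono_tags, lifting) ComplD lessThan_iff linorder_not_less mem_Collect_eq subsetI)
  then show ?L using finite_subset finite_lessThan by blast
qed

subsection \<open>Segments in a rotated frame\<close>

text \<open>The map z \<mapsto> o + u z with a unit u of the Gaussian integers: a rotation and a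
  translation, so it preserves turns.\<close>

locale frame =
  fixes ox oy ux uy :: int
  assumes unit: "ux * ux + uy * uy = 1"
begin

fun lin :: "point \<Rightarrow> point" where
  "lin (x, y) = (ux * x - uy * y, uy * x + ux * y)"

definition emb :: "point \<Rightarrow> point" where
  "emb p = (ox, oy) + lin p"

definition seg :: "arc \<Rightarrow> segment" where
  "seg e = (emb (start e), emb (head e))"

lemma unit_cases: "(ux = 1 \<and> uy = 0) \<or> (ux = -1 \<and> uy = 0) \<or> (ux = 0 \<and> uy = 1) \<or> (ux = 0 \<and> uy = -1)"
proof -
  have "ux\<^sup>2 + uy\<^sup>2 = 1" using unit by (simp add: power2_eq_square)
  then have "ux\<^sup>2 \<le> 1" "uy\<^sup>2 \<le> 1" using zero_le_power2[of ux] zero_le_power2[of uy] by linarith+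
  then have "\<bar>ux\<bar> \<le> 1" "\<bar>uy\<bar> \<le> 1" by (simp_all add: abs_square_le_1)
  then have "ux = -1 \<or> ux = 0 \<or> ux = 1" "uy = -1 \<or> uy = 0 \<or> uy = 1" by linarith+
  then show ?thesis using unit by auto
qed

lemma lin_add: "lin (p + q) = lin p + lin q"
  by (cases p; cases q) (simp add: algebra_simps)

lemma lin_diff: "lin (p - q) = lin p - lin q"
  by (cases p; cases q) (simp add: algebra_simps)

lemma lin_surj: "\<exists>q. p = lin q"
proof -
  have "p = lin (ux * fst p + uy * snd p, - (uy * fst p) + ux * snd p)"
    using unit_cases by (cases p) auto
  then show ?thesis by blast
qed

lemma lin_eq_0: "lin p = 0 \<longleftrightarrow> p = 0"
  using unit_cases by (cases p) (auto simp: zero_prod_def)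

lemma lin_inject: "lin p = lin q \<longleftrightarrow> p = q"
  using lin_eq_0[of "p - q"] by (simp add: lin_diff)

lemma emb_inject [simp]: "emb p = emb q \<longleftrightarrow> p = q"
  by (simp add: emb_def lin_inject)

lemma emb_surj: "\<exists>q. p = emb q"
proof -
  obtain q where "p - (ox, oy) = lin q" using lin_surj by blast
  then have "p = emb q" unfolding emb_def diff_eq_eq by (simp only: add.commute)
  then show ?thesis by blast
qed

lemma emb_add: "emb (p + q) = lin p + emb q"
  by (simp add: emb_def lin_add algebra_simps)

lemma emb_diff: "emb p - emb q = lin (p - q)"
  by (simp add: emb_def lin_diff)

lemma perp_lin: "perp (lin p) (lin q) \<longleftrightarrow> perp p q"
  using unit_cases by (cases p; cases q) (auto simp: perp_def algebra_simps)

lemma cross_lin: "cross (lin p) (lin q) = cross p q"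
  using unit_cases by (cases p; cases q) (auto simp: cross_def algebra_simps)

lemma abs_lin: "\<bar>fst (lin p)\<bar> + \<bar>snd (lin p)\<bar> = \<bar>fst p\<bar> + \<bar>snd p\<bar>"
  using unit_cases by (cases p) auto

lemma lin_bounded:
  assumes "\<bar>fst (lin p)\<bar> \<le> r" "\<bar>snd (lin p)\<bar> \<le> r"
  shows "\<bar>fst p\<bar> \<le> r" "\<bar>snd p\<bar> \<le> r"
  using assms unit_cases by (cases p; auto)+

lemma unit_vector_cases:
  fixes p :: point
  assumes "\<bar>fst p\<bar> + \<bar>snd p\<bar> = 1"
  shows "p = (1, 0) \<or> p = (-1, 0) \<or> p = (0, 1) \<or> p = (0, -1)"
  using assms by (cases p) auto

lemma segmentE:
  assumes "is_segment c"
  obtains p d where "c = (emb p, emb (p + d))" "d = (1, 0) \<or> d = (-1, 0) \<or> d = (0, 1) \<or> d = (0, -1)"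
proof -
  obtain p q where pq: "fst c = emb p" "snd c = emb q" using emb_surj by metis
  have "\<bar>fst (q - p)\<bar> + \<bar>snd (q - p)\<bar> = 1"
    using assms abs_lin[of "q - p"] unfolding is_segment_def dir_def pq emb_diff by simp
  from that[of p "q - p"] unit_vector_cases[OF this] pq show ?thesis by (cases c) auto
qed

lemma dir_seg: "dir (seg e) = lin (head e - start e)"
  by (simp add: dir_def seg_def emb_diff)

lemma is_segment_seg: "is_arc e \<Longrightarrow> is_segment (seg e)"
  unfolding is_segment_def dir_seg abs_lin by (cases e) auto

lemma seg_inject: "is_arc e \<Longrightarrow> is_arc f \<Longrightarrow> seg e = seg f \<longleftrightarrow> e = f"
  by (cases e; cases f) (auto simp: seg_def split: if_splits)

text \<open>Horizontal arcs start at even vertices and vertical ones at odd vertices, so the reverse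
  of an arc is not an arc.\<close>

lemma support_seg_inject:
  assumes "is_arc e" "is_arc f" "support (seg e) = support (seg f)"
  shows "e = f"
proof -
  obtain x y d where e: "e = (x, y, d)" by (cases e)
  obtain x' y' d' where f: "f = (x', y', d')" by (cases f)
  have "(start e = start f \<and> head e = head f) \<or> (start e = head f \<and> head e = start f)"
    using assms(3) by (auto simp: support_def seg_def doubleton_eq_iff)
  then show ?thesis
  proof
    assume "start e = start f \<and> head e = head f"
    then show ?thesis using seg_inject[OF assms(1,2)] by (simp add: seg_def)
  next
    assume "start e = head f \<and> head e = start f"
    then show ?thesis using assms(1,2) unfolding e f
      by (cases "even (x + y)"; cases "even (x' + y')") auto
  qed
qed

lemma support_is_seg:
  assumes "is_segment c"
  obtains e where "is_arc e" "support (seg e) = support c"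
proof -
  obtain p d where c: "c = (emb p, emb (p + d))" and d: "d = (1, 0) \<or> d = (-1, 0) \<or> d = (0, 1) \<or> d = (0, -1)"
    using segmentE[OF assms] by blast
  obtain x y where p: "p = (x, y)" by (cases p)
  \<comment> \<open>If c violates the parity convention, its reverse obeys it.\<close>
  define e where "e = (if even (x + y) = (snd d = 0) then (x, y, fst d + snd d)
    else (x + fst d, y + snd d, - (fst d + snd d)))"
  have "is_arc e" using d by (auto simp: e_def)
  moreover have "support (seg e) = support c"
    using d unfolding e_def seg_def support_def c p by (cases "even (x + y)") (auto simp: insert_commute)
  ultimately show ?thesis using that by blast
qed

definition turn_sign :: "segment \<Rightarrow> segment \<Rightarrow> int" where
  "turn_sign c c' = (if cross (dir c) (dir c') > 0 then 1 else -1)"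

lemma seg_step:
  assumes "is_arc e" "is_segment c" "snd (seg e) = fst c" "perp (dir (seg e)) (dir c)"
  shows "c = seg (step (turn_sign (seg e) c) e)"
proof -
  obtain p d where c: "c = (emb p, emb (p + d))" and d: "d = (1, 0) \<or> d = (-1, 0) \<or> d = (0, 1) \<or> d = (0, -1)"
    using segmentE[OF assms(2)] by blast
  have p: "p = head e" using assms(3) by (simp add: c seg_def)
  have dc: "dir c = lin d" by (simp add: c dir_def emb_diff)
  have pd: "perp (head e - start e) d" using assms(4) by (simp add: dir_seg dc perp_lin)
  obtain x y b where e: "e = (x, y, b)" by (cases e)
  have b: "b = 1 \<or> b = -1" using assms(1) by (simp add: e)
  have "turn_sign (seg e) c = (if cross (head e - start e) d > 0 then 1 else -1)"
    by (simp add: turn_sign_def dir_seg dc cross_lin)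
  moreover have "head (step (if cross (head e - start e) d > 0 then 1 else -1) e) = head e + d"
    using pd d b unfolding e
    by (cases "even (x + y)"; elim disjE) (simp_all add: perp_def cross_def)
  ultimately show ?thesis by (simp add: seg_def c p)
qed

lemma seg_back:
  assumes "is_arc e" "is_segment c" "snd c = fst (seg e)" "perp (dir c) (dir (seg e))"
  obtains f where "is_arc f" "c = seg f"
proof -
  obtain p d where c: "c = (emb p, emb (p + d))" and d: "d = (1, 0) \<or> d = (-1, 0) \<or> d = (0, 1) \<or> d = (0, -1)"
    using segmentE[OF assms(2)] by blast
  have p: "p + d = start e" using assms(3) by (simp add: c seg_def)
  have dc: "dir c = lin d" by (simp add: c dir_def emb_diff)
  have pd: "perp d (head e - start e)" using assms(4) by (simp add: dir_seg dc perp_lin)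
  obtain x y where p': "p = (x, y)" by (cases p)
  obtain x0 y0 d0 where e: "e = (x0, y0, d0)" by (cases e)
  have "c = seg (x, y, fst d + snd d)" "is_arc (x, y, fst d + snd d)"
    using p pd d assms(1) unfolding p' e c seg_def
    by (cases "even (x0 + y0)"; auto simp: perp_def)+
  then show ?thesis using that by blast
qed

lemma turn_sign_step:
  assumes "is_arc e" "t = 1 \<or> t = -1"
  shows "turn_sign (seg e) (seg (step t e)) = t"
  using assms unfolding turn_sign_def dir_seg cross_lin
  by (cases e) (auto simp: cross_def)

end

subsection \<open>Transfer by the local isomorphism property\<close>

lemma curve_of_eq: "curve_of C = range (\<lambda>k i. C (i + k))"
  by (auto simp: curve_of_def shift_rel_def)

lemma curve_of_shift: "curve_of (\<lambda>i. C (i + k)) = curve_of C"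
proof
  show "curve_of (\<lambda>i. C (i + k)) \<subseteq> curve_of C"
  proof
    fix D assume "D \<in> curve_of (\<lambda>i. C (i + k))"
    then obtain l where "D = (\<lambda>i. C (i + (l + k)))" by (auto simp: curve_of_eq add.assoc)
    then show "D \<in> curve_of C" by (auto simp: curve_of_eq)
  qed
  show "curve_of C \<subseteq> curve_of (\<lambda>i. C (i + k))"
  proof
    fix D assume "D \<in> curve_of C"
    then obtain l where "D = (\<lambda>i. C (i + l))" by (auto simp: curve_of_eq)
    then have "D = (\<lambda>i. C (i + (l - k) + k))" by simp
    then show "D \<in> curve_of (\<lambda>i. C (i + k))" unfolding curve_of_eq by (rule range_eqI)
  qed
qed

lemma complete_curve_shift:
  assumes "complete_curve C"
  shows "complete_curve (\<lambda>i. C (i + k))"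
proof -
  have "i + 1 + k = i + k + 1" for i by simp
  moreover have "inj (\<lambda>i. support (C (i + k)))"
    using assms unfolding complete_curve_def inj_def by (metis add_right_cancel)
  ultimately show ?thesis using assms unfolding complete_curve_def by metis
qed

lemma segments_of_curve_of: "segments_of (curve_of C) = range C"
proof -
  have "C i \<in> (\<Union>k. range (\<lambda>i. C (i + k)))" for i by (auto intro: exI[of _ 0])
  then show ?thesis by (auto simp: segments_of_def curve_of_eq)
qed

lemma curve_of_self: "C \<in> curve_of C"
proof -
  have "C = (\<lambda>i. C (i + 0))" by simp
  then show ?thesis unfolding curve_of_eq by (rule range_eqI)
qed

lemma covering_curve:
  assumes "folding_covering \<C>" "K \<in> \<C>" "D \<in> K"
  shows "complete_curve D" "K = curve_of D"
proof -
  have "K \<in> complete_folding_curves" using assms by (auto simp: folding_covering_def)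
  then obtain C where C: "complete_curve C" "K = curve_of C"
    by (auto simp: complete_folding_curves_def quotient_def curve_of_def)
  then obtain k where "D = (\<lambda>i. C (i + k))" using assms(3) by (auto simp: curve_of_eq)
  then show "complete_curve D" "K = curve_of D"
    using C complete_curve_shift curve_of_shift by simp_all
qed

lemma covering_unique:
  assumes "folding_covering \<C>" "K \<in> \<C>" "K' \<in> \<C>" "c \<in> segments_of K" "c' \<in> segments_of K'"
    "support c = support c'" "is_segment c"
  shows "K = K'" "c = c'"
proof -
  have "support c \<in> unit_edges" using assms(7) by (simp add: unit_edges_def)
  then have "\<exists>!x. case x of (K, d) \<Rightarrow> K \<in> \<C> \<and> d \<in> segments_of K \<and> support d = support c"
    using assms(1) by (simp add: folding_covering_def)
  then have "(K, c) = (K', c')" using assms by (elim ex1E) (metis (mono_tags, lifting) case_prod_conv)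
  then show "K = K'" "c = c'" by simp_all
qed

context frame begin

text \<open>The parity convention passes to both neighbours of a segment, since direction and parity
  of the vertex alternate together; one segment that obeys it is enough.\<close>

lemma curve_arcs:
  assumes "complete_curve C" "is_arc e" "seg e = C k"
  obtains w where "\<And>h. is_arc (w h)" "\<And>h. seg (w h) = C (h + k)" "w 0 = e"
    "\<And>h. w (h + 1) = step (turns C (h + k)) (w h)"
proof -
  have cc: "is_segment (C i)" "snd (C i) = fst (C (i + 1))" "perp (dir (C i)) (dir (C (i + 1)))" for i
    using assms(1) by (auto simp: complete_curve_def)
  have fwd: "C (i + 1) = seg (step (turns C i) f)" if "is_arc f" "seg f = C i" for f i
    using seg_step[OF that(1) cc(1)[of "i + 1"]] cc[of i] that(2) by (simp add: turns_def turn_sign_def)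
  have arc_fwd: "is_arc (step (turns C i) f)" if "is_arc f" for f i
    using that by (intro is_arc_step) (auto simp: turns_def)
  have ex: "\<exists>f. is_arc f \<and> seg f = C i" for i
  proof (induction i rule: int_induct[of _ k])
    case base
    then show ?case using assms by blast
  next
    case (step1 i)
    then show ?case using fwd arc_fwd by metis
  next
    case (step2 i)
    then obtain f where "is_arc f" "seg f = C i" by blast
    then show ?case using seg_back[of f "C (i - 1)"] cc[of "i - 1"] by (metis diff_add_cancel)
  qed
  then have "\<forall>h. \<exists>f. is_arc f \<and> seg f = C (h + k)" by blast
  then obtain w where w: "\<And>h. is_arc (w h) \<and> seg (w h) = C (h + k)" by metis
  show ?thesis
  proof (rule that)
    show "w 0 = e" using w[of 0] assms(2,3) seg_inject[of "w 0" e] by simp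
    show "w (h + 1) = step (turns C (h + k)) (w h)" for h
    proof -
      have "seg (w (h + 1)) = seg (step (turns C (h + k)) (w h))"
        using w[of "h + 1"] fwd[of "w h" "h + k"] w[of h] by (simp add: algebra_simps)
      then show ?thesis using seg_inject w arc_fwd by blast
    qed
  qed (use w in auto)
qed

lemma emb_mem_cball:
  assumes "(case emb p of (x, y) \<Rightarrow> (real_of_int x, real_of_int y)) \<in> cball (case emb q of (x, y) \<Rightarrow> (real_of_int x, real_of_int y)) r"
    "r \<le> real_of_int \<rho>"
  shows "\<bar>fst (p - q)\<bar> \<le> \<rho>" "\<bar>snd (p - q)\<bar> \<le> \<rho>"
proof -
  obtain x y where p: "emb p = (x, y)" by (cases "emb p")
  obtain x' y' where q: "emb q = (x', y')" by (cases "emb q")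
  have d: "dist (real_of_int x', real_of_int y') (real_of_int x, real_of_int y) \<le> r"
    using assms(1) by (simp add: p q)
  have "dist (real_of_int x') (real_of_int x) \<le> r" "dist (real_of_int y') (real_of_int y) \<le> r"
    using order_trans[OF dist_fst_le d] order_trans[OF dist_snd_le d] by simp_all
  then have "\<bar>real_of_int (x - x')\<bar> \<le> real_of_int \<rho>" "\<bar>real_of_int (y - y')\<bar> \<le> real_of_int \<rho>"
    using assms(2) by (auto simp: dist_real_def)
  then have "\<bar>x - x'\<bar> \<le> \<rho>" "\<bar>y - y'\<bar> \<le> \<rho>" by linarith+
  moreover have "lin (p - q) = (x - x', y - y')" using emb_diff[of p q] by (simp add: p q)
  ultimately show "\<bar>fst (p - q)\<bar> \<le> \<rho>" "\<bar>snd (p - q)\<bar> \<le> \<rho>" using lin_bounded[of "p - q"] by simp_all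
qed

end

lemma head_shift:
  assumes "even (fst v + snd v)"
  shows "head (shift v e) = v + head e"
  using assms by (cases v; cases e) auto

lemma start_shift [simp]: "start (shift v e) = v + start e"
  by (cases v; cases e) auto

lemma is_arc_shift [simp]: "is_arc (shift v e) = is_arc e"
  by (cases v; cases e) auto

lemma step_shift:
  assumes "even (fst v + snd v)"
  shows "step t (shift v e) = shift v (step t e)"
  using assms by (cases v; cases e) auto

text \<open>The offset in \<open>seg (w h) = C (h + 1)\<close> reconciles two conventions:
  \<open>turns C h\<close> is the turn between \<open>C h\<close> and \<open>C (h + 1)\<close>, made
  at the start of \<open>w h\<close>.\<close>

locale covered_plane = folding_plane \<alpha> \<epsilon> + frame ox oy ux uy
  for \<alpha> :: "nat \<Rightarrow> int" and \<epsilon> ox oy ux uy :: int +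
  fixes s :: "int \<Rightarrow> int" and C :: "int \<Rightarrow> segment" and w :: "int \<Rightarrow> arc" and \<C> :: "curve set"
  assumes toeplitz_s: "toeplitz 0 s"
    and curve_C: "complete_curve C" and turns_C: "turns C = s"
    and arc_w: "is_arc (w h)" and seg_w: "seg (w h) = C (h + 1)" and w_0: "w 0 = (0, 0, 1)"
    and w_step: "w (h + 1) = step (s (h + 1)) (w h)"
    and covering: "folding_covering \<C>" and C_mem: "curve_of C \<in> \<C>"
    and local_iso: "local_isomorphism \<C>"
begin

lemma walk_w: "walk s w"
  by (simp add: walk_def arc_w w_step)

lemma w_nxt: "w (h + 1) = nxt 0 (w h)"
  using walk_nxt[OF walk_w toeplitz_s w_0] .

lemma C_eq_seg: "C i = seg (w (i - 1))"
  using seg_w[of "i - 1"] by simp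

lemma conn_range_w: "conn 0 f e \<Longrightarrow> f \<in> range w \<Longrightarrow> e \<in> range w"
proof (induction rule: conn.induct)
  case (conn_fwd e f)
  then obtain h where "f = w h" by blast
  then have "nxt 0 f = w (h + 1)" using w_nxt by simp
  then show ?case by simp
next
  case (conn_bwd e f)
  then obtain h where "nxt 0 f = w h" by blast
  then have "nxt 0 f = nxt 0 (w (h - 1))" using w_nxt[of "h - 1"] by simp
  then show ?case using nxt_inject by blast
qed

lemma support_C_inject: "support (C i) = support (C j) \<Longrightarrow> i = j"
  using curve_C by (auto simp: complete_curve_def dest: injD)

lemma curve_segments: "K \<in> \<C> \<Longrightarrow> D \<in> K \<Longrightarrow> D i \<in> segments_of K"
  by (auto simp: segments_of_def)

lemma C_segments: "C i \<in> segments_of (curve_of C)"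
  by (simp add: segments_of_curve_of)

text \<open>The disk is placed around a vertex V such that all edges near V lie on C. Each
  translated segment then shares its support with a segment of C, and uniqueness in the covering
  identifies curve and orientation, hence also the neighbours.\<close>

lemma translate_into_C:
  assumes "finite F" "F \<subseteq> decorated_segments \<C>"
  obtains v where "\<And>d. d \<in> F \<Longrightarrow> \<exists>j. translate v d = (C j, support (C (j - 1)), support (C (j + 1)))"
proof -
  obtain r where r: "\<And>z. \<exists>v. translate v ` F \<subseteq> decorated_segments \<C> \<and>
      (\<Union>d\<in>translate v ` F. decorated_points d) \<subseteq> cball z r"
    using local_iso[unfolded local_isomorphism_def, rule_format, OF conjI[OF assms]] by metis
  obtain V where V: "\<And>x y d. is_arc (x, y, d) \<Longrightarrow> \<bar>x\<bar> \<le> \<lceil>r\<rceil> \<Longrightarrow> \<bar>y\<bar> \<le> \<lceil>r\<rceil> \<Longrightarrow>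
    conn 0 (shift V (x, y, d)) (0, 0, 1)" using conn_big_box[of "\<lceil>r\<rceil>"] by metis
  obtain v where v: "translate v ` F \<subseteq> decorated_segments \<C>"
    "(\<Union>d\<in>translate v ` F. decorated_points d) \<subseteq> cball (case emb V of (x, y) \<Rightarrow> (real_of_int x, real_of_int y)) r"
    using r[of "case emb V of (x, y) \<Rightarrow> (real_of_int x, real_of_int y)"] by (elim exE conjE)
  show ?thesis
  proof (rule that[of v])
    fix d assume "d \<in> F"
    then have "translate v d \<in> decorated_segments \<C>" using v(1) by blast
    then obtain D K i where D: "K \<in> \<C>" "D \<in> K" "translate v d = (D i, support (D (i - 1)), support (D (i + 1)))"
      by (auto simp: decorated_segments_def)
    note cD = covering_curve[OF covering D(1,2)]
    have seg_D: "is_segment (D i)" using cD(1) by (simp add: complete_curve_def)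
    then obtain e where e: "is_arc e" "support (seg e) = support (D i)" using support_is_seg by blast
    have "emb (start e) \<in> support (D i)" unfolding e(2)[symmetric] by (simp add: support_def seg_def)
    then have "(case emb (start e) of (x, y) \<Rightarrow> (real_of_int x, real_of_int y)) \<in> edge_points (support (D i))"
      unfolding edge_points_def by (intro hull_inc imageI)
    then have "(case emb (start e) of (x, y) \<Rightarrow> (real_of_int x, real_of_int y)) \<in> decorated_points (translate v d)"
      by (simp add: D(3) decorated_points_def)
    then have "(case emb (start e) of (x, y) \<Rightarrow> (real_of_int x, real_of_int y))
      \<in> cball (case emb V of (x, y) \<Rightarrow> (real_of_int x, real_of_int y)) r"
      using v(2) \<open>d \<in> F\<close> by blast
    from emb_mem_cball[OF this le_of_int_ceiling]
    have bd: "\<bar>fst (start e - V)\<bar> \<le> \<lceil>r\<rceil>" "\<bar>snd (start e - V)\<bar> \<le> \<lceil>r\<rceil>" .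
    obtain x y b where xyb: "e = (x, y, b)" by (cases e)
    obtain V1 V2 where V12: "V = (V1, V2)" by (cases V)
    have "conn 0 (shift V (x - V1, y - V2, b)) (0, 0, 1)"
      using V[of "x - V1" "y - V2" b] bd e(1) by (simp add: xyb V12)
    then have "conn 0 (0, 0, 1) e" by (simp add: V12 xyb conn_sym)
    then have "e \<in> range w" using conn_range_w w_0 by (metis rangeI)
    then obtain h where "e = w h" by blast
    then have sup: "support (D i) = support (C (h + 1))" using e(2) seg_w by simp
    then have K: "K = curve_of C" "D i = C (h + 1)"
      using covering_unique[OF covering D(1) C_mem curve_segments[OF D(1,2)] C_segments sup seg_D] by blast+
    then obtain k where k: "D = (\<lambda>i. C (i + k))" using D(2) by (auto simp: curve_of_eq)
    have "translate v d = (C (i + k), support (C (i + k - 1)), support (C (i + k + 1)))"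
      using D(3) by (simp add: k algebra_simps)
    then show "\<exists>j. translate v d = (C j, support (C (j - 1)), support (C (j + 1)))" by blast
  qed
qed

lemma translate_eq:
  "translate v (c, e, f) = (c', e', f') \<longleftrightarrow> (v + fst c, v + snd c) = c' \<and> (+) v ` e = e' \<and> (+) v ` f = f'"
  by (cases c) (auto simp: translate_def)

lemma support_translate: "(+) v ` support c = support (v + fst c, v + snd c)"
  by (simp add: support_def)

lemma turns_translate:
  assumes "\<And>h. h \<in> {i, i + 1} \<Longrightarrow> C (h + j) = (v + fst (C h), v + snd (C h))"
  shows "turns C (i + j) = turns C i"
proof -
  have "dir (C (h + j)) = dir (C h)" if "h \<in> {i, i + 1}" for h
    using assms[OF that] by (simp add: dir_def)
  then have "dir (C (i + j)) = dir (C i)" "dir (C (i + 1 + j)) = dir (C (i + 1))" by blast+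
  moreover have "C (i + j + 1) = C (i + 1 + j)" by (simp add: algebra_simps)
  ultimately show ?thesis by (simp add: turns_def)
qed

text \<open>A translation that maps a long piece of \<open>C\<close> into \<open>C\<close> belongs to the lattice of the \<open>k\<close>-th
  derivative; translating a segment of another curve along with such a piece carries the turns of
  \<open>C\<close> over to that curve.\<close>

lemma local_pattern:
  assumes "K \<in> \<C>" "D \<in> K" "k \<ge> 1"
  obtains e W p where "is_arc e" "D i = seg e" "W = scale 0 k p" "even (fst W + snd W)"
    "D (i + 1) = seg (step (turn 0 (W + head e)) e)"
proof -
  \<comment> \<open>The window of \<open>toeplitz_recognizable\<close>, plus 1 because a turn
    involves two segments.\<close>
  define M :: int where "M = 8 * 2 ^ k + 1"
  define dec where "dec E h = (E h, support (E (h - 1)), support (E (h + 1)))" for E :: "int \<Rightarrow> segment" and h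
  define F where "F = insert (dec D i) (dec C ` {0..M})"
  have "F \<subseteq> decorated_segments \<C>"
    using assms(1,2) C_mem curve_of_self[of C] unfolding F_def dec_def decorated_segments_def by blast
  moreover have "finite F" by (simp add: F_def)
  ultimately obtain v where v: "\<And>d. d \<in> F \<Longrightarrow> \<exists>j. translate v d = dec C j"
    using translate_into_C[of F] unfolding dec_def by metis
  then have "\<forall>h\<in>{0..M}. \<exists>j. translate v (dec C h) = dec C j" by (simp add: F_def)
  then obtain J where J: "\<And>h. 0 \<le> h \<Longrightarrow> h \<le> M \<Longrightarrow> translate v (dec C h) = dec C (J h)"
    by (metis atLeastAtMost_iff)
  \<comment> \<open>The decorations record the next support, so C runs through the translated piece
    without gaps.\<close>
  have Jh: "J h = h + J 0" if "0 \<le> h" "h \<le> M" for h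
    using that
  proof (induction h rule: int_ge_induct)
    case (step h)
    have "(+) v ` support (C (h + 1)) = support (C (J h + 1))"
      using J[of h] step by (simp add: dec_def translate_eq)
    moreover have "(+) v ` support (C (h + 1)) = support (C (J (h + 1)))"
      using J[of "h + 1"] step by (simp add: dec_def translate_eq support_translate)
    ultimately have "J (h + 1) = J h + 1" using support_C_inject by metis
    then show ?case using step by simp
  qed simp
  have tr: "C (h + J 0) = (v + fst (C h), v + snd (C h))" if "0 \<le> h" "h \<le> M" for h
    using J[OF that] unfolding Jh[OF that] dec_def translate_eq by (elim conjE) (rule sym)
  have "s (J 0 + h) = s h" if "0 \<le> h" "h \<le> 8 * 2 ^ k" for h
  proof -
    have "turns C (h + J 0) = turns C h"
      by (rule turns_translate[of _ _ v], rule tr) (use that in \<open>auto simp: M_def\<close>)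
    then show ?thesis by (simp add: turns_C add.commute)
  qed
  then have "2 ^ k dvd J 0" using toeplitz_recognizable[OF toeplitz_s] by blast
  then obtain m where m: "J 0 = 2 ^ k * m" by (elim dvdE)
  obtain p where p: "start (w (J 0)) = scale 0 k p"
    using walk_start_dvd[OF walk_w toeplitz_s w_0, of k m] unfolding m by blast
  define W where "W = scale 0 k p"
  have W: "even (fst W + snd W)"
    using assms(3) even_odot[OF \<alpha>] unfolding W_def by (cases k) auto
  \<comment> \<open>\<open>C 1\<close> starts at the origin of the frame, so its image exhibits v as
    a vector of the lattice of level k.\<close>
  have vW: "v = lin W"
  proof -
    have "1 \<le> M" unfolding M_def by simp
    then have "emb (start (w (J 0))) = v + emb (start (w 0))"
      using tr[of 1] unfolding C_eq_seg by (simp add: seg_def)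
    moreover have "start (w 0) = 0" by (simp add: w_0 zero_prod_def)
    ultimately have "emb (W + 0) = v + emb 0" unfolding p W_def by simp
    then show ?thesis unfolding emb_add by simp
  qed
  obtain l where l: "translate v (dec D i) = dec C l" using v[of "dec D i"] unfolding F_def by blast
  define g where "g = w (l - 1)"
  have Cl: "C l = seg g" "C (l + 1) = seg (nxt 0 g)"
    using C_eq_seg[of l] C_eq_seg[of "l + 1"] w_nxt[of "l - 1"] by (simp_all add: g_def)
  define e where "e = shift (- W) g"
  have W': "even (fst (- W) + snd (- W))" using W by simp
  have arc: "is_arc e" by (simp add: e_def g_def arc_w)
  have pts: "W + start e = start g" "W + head e = head g"
    unfolding e_def head_shift[OF W'] by simp_all
  have Di: "D i = seg e"
  proof -
    have "(v + fst (D i), v + snd (D i)) = seg g" using l Cl(1) by (simp add: dec_def translate_eq)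
    then have "v + fst (D i) = emb (W + start e)" "v + snd (D i) = emb (W + head e)"
      by (simp_all add: seg_def pts)
    then show ?thesis unfolding emb_add vW by (simp add: seg_def prod_eq_iff)
  qed
  define f where "f = step (turn 0 (W + head e)) e"
  have "nxt 0 g = step (turn 0 (W + head e)) g" by (simp add: nxt_def pts)
  then have f: "f = shift (- W) (nxt 0 g)" by (simp add: f_def e_def step_shift[OF W'])
  have ptsf: "W + start f = start (nxt 0 g)" "W + head f = head (nxt 0 g)"
    unfolding f head_shift[OF W'] by simp_all
  have "D (i + 1) = seg f"
  proof -
    \<comment> \<open>The decoration yields only the support of the next segment; its initial point
      is known from \<open>D i\<close>, and this fixes the orientation.\<close>
    note cD = covering_curve(1)[OF covering assms(1,2)]
    have fst: "fst (D (i + 1)) = emb (start f)"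
      using cD Di by (metis complete_curve_def f_def seg_def snd_conv start_step)
    have "(+) v ` support (D (i + 1)) = support (seg (nxt 0 g))"
      using l Cl(2) by (simp add: dec_def translate_eq)
    then have "{v + fst (D (i + 1)), v + snd (D (i + 1))} = {emb (W + start f), emb (W + head f)}"
      by (simp add: support_def seg_def ptsf)
    then have "{lin W + emb (start f), lin W + snd (D (i + 1))} = {lin W + emb (start f), lin W + emb (head f)}"
      unfolding fst vW emb_add .
    then have "snd (D (i + 1)) = emb (head f)" by (auto simp: doubleton_eq_iff)
    then show ?thesis using fst by (simp add: seg_def prod_eq_iff)
  qed
  then show ?thesis using that[OF arc Di W_def W] by (simp add: f_def)
qed

text \<open>Away from 0 the lattice is taken so coarse that translation by W does not change the
  turn. At 0 the turn found at the translated vertex may be wrong, and the curve C itself excludes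
  this.\<close>

lemma curve_follows_nxt:
  assumes "K \<in> \<C>" "D \<in> K"
  obtains e where "is_arc e" "D i = seg e" "D (i + 1) = seg (nxt 0 e)"
proof -
  obtain q where q: "snd (D i) = emb q" using emb_surj by blast
  have qe: "q = head e" if "D i = seg e" for e using q that by (simp add: seg_def)
  show ?thesis
  proof (cases "q = (0, 0)")
    case False
    then obtain k where k: "k \<ge> 1" "\<And>p. turn 0 (q + scale 0 k p) = turn 0 q"
      using turn_periodic[of q 0] by blast
    obtain e W p where e: "is_arc e" "D i = seg e" "W = scale 0 k p"
      "D (i + 1) = seg (step (turn 0 (W + head e)) e)" using local_pattern[OF assms k(1)] by metis
    then have "turn 0 (W + head e) = turn 0 (head e)" using k(2)[of p] qe by (simp add: add.commute)
    then show ?thesis using that e by (simp add: nxt_def)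
  next
    case True
    obtain e W where e: "is_arc e" "D i = seg e" "D (i + 1) = seg (step (turn 0 (W + head e)) e)"
      using local_pattern[OF assms, of 1] by (metis order_refl)
    define t where "t = turn 0 (W + head e)"
    have t: "t = 1 \<or> t = -1" by (simp add: t_def turn_cases)
    have two: "f = (0, 1, -1) \<or> f = (0, -1, 1)" if "is_arc f" "head f = (0, 0)" for f
    proof -
      obtain x y b where f: "f = (x, y, b)" by (cases f)
      show ?thesis using that by (cases "even (x + y)") (auto simp: f add_eq_0_iff)
    qed
    have head_e: "head e = (0, 0)" using qe e(2) True by simp
    have w1: "nxt 0 (w (-1)) = (0, 0, 1)" using w_nxt[of "-1"] w_0 by simp
    then have "head (w (-1)) = (0, 0)" by (metis start.simps start_nxt)
    then have nx: "nxt 0 (w (-1)) = step \<epsilon> (w (-1))" "nxt 0 e = step \<epsilon> e" using head_e by (simp_all add: nxt_def)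
    have C0: "C 0 = seg (w (-1))" "C 1 = seg (0, 0, 1)" using C_eq_seg[of 0] C_eq_seg[of 1] w_0 by simp_all
    have sg: "is_segment (D h)" for h using covering_curve(1)[OF covering assms] by (simp add: complete_curve_def)
    have coincide: "D (h + 1) = C (j + 1) \<and> D (h - 1) = C (j - 1)" if "D h = C j" for h j
    proof -
      have "K = curve_of C"
        using covering_unique(1)[OF covering assms(1) C_mem curve_segments[OF assms, of h] C_segments[of j]] that sg[of h] by simp
      then obtain k where k: "D = (\<lambda>i. C (i + k))" using assms(2) by (auto simp: curve_of_eq)
      then have "h + k = j" using that support_C_inject by (metis)
      then have "C (h + 1 + k) = C (j + 1)" "C (h - 1 + k) = C (j - 1)" by (simp_all add: algebra_simps)
      then show ?thesis unfolding k by blast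
    qed
    show ?thesis
    proof (cases "e = w (-1)")
      case True
      then have "D (i + 1) = C 1" using coincide[of i 0] e(2) C0(1) by simp
      then show ?thesis using that[OF e(1,2)] True w1 C0(2) by simp
    next
      case False
      \<comment> \<open>With the other turn, D would leave 0 along \<open>C 1\<close>, whose
        predecessor on C is the other edge entering 0.\<close>
      have "t = \<epsilon>"
      proof (rule ccontr)
        assume "t \<noteq> \<epsilon>"
        then have "t = - \<epsilon>" using t \<epsilon> by auto
        then have "step t e = (0, 0, 1)"
          using False two[OF e(1) head_e] two[OF arc_w \<open>head (w (-1)) = (0, 0)\<close>] w1 nx(1) by auto
        then have "D (i + 1) = C 1" using e(3) C0(2) by (simp add: t_def)
        then have "seg e = seg (w (-1))" using coincide[of "i + 1" 1] C0(1) e(2) by simp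
        then show False using False seg_inject[OF e(1) arc_w] by simp
      qed
      then show ?thesis using that[OF e(1,2)] e(3) nx(2) by (simp add: t_def)
    qed
  qed
qed

end

subsection \<open>Counting the curves\<close>

text \<open>The point reflection in 0. It preserves all turns and maps C to the second curve with
  sequence S.\<close>

fun neg_arc :: "arc \<Rightarrow> arc" where
  "neg_arc (x, y, d) = (- x, - y, - d)"

lemma head_neg_arc: "head (neg_arc e) = - head e"
  by (cases e) auto

lemma start_neg_arc: "start (neg_arc e) = - start e"
  by (cases e) auto

lemma step_neg_arc: "step t (neg_arc e) = neg_arc (step t e)"
  by (cases e) auto

context folding_plane begin

lemma turn_minus: "turn n (- p) = turn n p"
proof (induction n p rule: turn.induct)
  case (1 n p)
  show ?case
  proof (cases "p = (0, 0)")
    case True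
    then show ?thesis by simp
  next
    case False
    show ?thesis
    proof (cases "even (fst p + snd p)")
      case True
      then obtain q where q: "p = odot (\<alpha> n) q" using even_point_odot[OF \<alpha>] by blast
      moreover have "- odot (\<alpha> n) q = odot (\<alpha> n) (- q)" by (cases q) simp
      ultimately show ?thesis using 1[OF False] True \<alpha>[of n] by simp
    next
      case odd: False
      then have "odd (fst (- p) + snd (- p))" by simp
      then show ?thesis using turn_odd[OF odd] turn_odd[of "- p"] by (simp add: sg_def)
    qed
  qed
qed

lemma nxt_neg_arc: "nxt n (neg_arc e) = neg_arc (nxt n e)"
  by (simp add: nxt_def head_neg_arc turn_minus step_neg_arc)

end

context covered_plane begin

section \<open>Curves of the covering as classes of edges\<close>

definition arcs_of :: "curve \<Rightarrow> arc set" where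
  "arcs_of K = {e. is_arc e \<and> seg e \<in> segments_of K}"

lemma arcs_ofE:
  assumes "K \<in> \<C>" "e \<in> arcs_of K"
  obtains D i where "D \<in> K" "D i = seg e"
  using assms by (auto simp: arcs_of_def segments_of_def)

lemma arcs_ofI: "K \<in> \<C> \<Longrightarrow> D \<in> K \<Longrightarrow> D i = seg e \<Longrightarrow> is_arc e \<Longrightarrow> e \<in> arcs_of K"
  using curve_segments[of K D i] by (simp add: arcs_of_def)

lemma curve_nxt:
  assumes "K \<in> \<C>" "D \<in> K" "is_arc e" "D i = seg e"
  shows "D (i + 1) = seg (nxt 0 e)"
proof -
  obtain f where "is_arc f" "D i = seg f" "D (i + 1) = seg (nxt 0 f)"
    using curve_follows_nxt[OF assms(1,2)] by metis
  with assms show ?thesis using seg_inject by metis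
qed

lemma arcs_of_unique: "K \<in> \<C> \<Longrightarrow> K' \<in> \<C> \<Longrightarrow> e \<in> arcs_of K \<Longrightarrow> e \<in> arcs_of K' \<Longrightarrow> K = K'"
  using covering_unique(1)[OF covering, of K K' "seg e" "seg e"] is_segment_seg by (auto simp: arcs_of_def)

lemma arcs_of_exists:
  assumes "is_arc e"
  obtains K where "K \<in> \<C>" "e \<in> arcs_of K"
proof -
  have "support (seg e) \<in> unit_edges" using is_segment_seg[OF assms] by (auto simp: unit_edges_def)
  then obtain K c where K: "K \<in> \<C>" "c \<in> segments_of K" "support c = support (seg e)"
    using covering unfolding folding_covering_def by (metis (mono_tags, lifting) case_prodE)
  then obtain D i where D: "D \<in> K" "c = D i" by (auto simp: segments_of_def)
  obtain f where "is_arc f" "D i = seg f" using curve_follows_nxt[OF K(1) D(1)] by metis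
  moreover from this have "f = e" using support_seg_inject[OF _ assms] K(3) D(2) by simp
  ultimately show ?thesis using that K arcs_ofI[OF K(1) D(1)] by blast
qed

lemma arcs_of_conn:
  assumes "K \<in> \<C>" "e \<in> arcs_of K" "f \<in> arcs_of K"
  shows "conn 0 e f"
proof -
  obtain D i where D: "D \<in> K" "D i = seg e" using arcs_ofE[OF assms(1,2)] .
  have arc: "is_arc e" "is_arc f" using assms by (auto simp: arcs_of_def)
  have "seg f \<in> range D"
    using assms(3) covering_curve(2)[OF covering assms(1) D(1)] segments_of_curve_of[of D] by (auto simp: arcs_of_def)
  then obtain j where j: "D j = seg f" by (metis rangeE)
  have along: "\<exists>h. conn 0 g h \<and> D (k + int n) = seg h" if "is_arc g" "D k = seg g" for g k n
  proof (induction n)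
    case 0
    show ?case using that conn_refl[OF that(1)] by (metis add.right_neutral of_nat_0)
  next
    case (Suc n)
    then obtain h where h: "conn 0 g h" "D (k + int n) = seg h" by blast
    then have "D (k + int n + 1) = seg (nxt 0 h)" using curve_nxt[OF assms(1) D(1)] conn_arcs by blast
    moreover have "k + int (Suc n) = k + int n + 1" by simp
    ultimately show ?case using conn_fwd[OF h(1)] by metis
  qed
  have eq: "h = g" if "conn 0 x h" "seg h = seg g" "is_arc g" for x h g
    using that conn_arcs seg_inject by blast
  show ?thesis
  proof (cases "i \<le> j")
    case True
    then have "i + int (nat (j - i)) = j" by simp
    then show ?thesis using along[OF arc(1) D(2), of "nat (j - i)"] eq j arc(2) by metis
  next
    case False
    then have "j + int (nat (i - j)) = i" by simp
    then have "conn 0 f e" using along[OF arc(2) j, of "nat (i - j)"] eq D(2) arc(1) by metis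
    then show ?thesis by (rule conn_sym)
  qed
qed

text \<open>For a backward step, the curve through f also runs through \<open>nxt 0 f\<close>, so
  uniqueness identifies it with K.\<close>

lemma conn_arcs_of:
  assumes "conn 0 e f" "K \<in> \<C>" "e \<in> arcs_of K"
  shows "f \<in> arcs_of K"
  using assms
proof (induction rule: conn.induct)
  case (conn_fwd e f)
  then have f: "f \<in> arcs_of K" by blast
  then obtain D i where D: "D \<in> K" "D i = seg f" using arcs_ofE[OF conn_fwd.prems(1)] by blast
  have "is_arc f" using f by (simp add: arcs_of_def)
  then have "D (i + 1) = seg (nxt 0 f)" "is_arc (nxt 0 f)" using curve_nxt[OF conn_fwd.prems(1) D(1) _ D(2)] by simp_all
  then show ?case using arcs_ofI[OF conn_fwd.prems(1) D(1)] by blast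
next
  case (conn_bwd e f)
  then have nf: "nxt 0 f \<in> arcs_of K" by blast
  obtain K' where K': "K' \<in> \<C>" "f \<in> arcs_of K'" using arcs_of_exists[OF conn_bwd.hyps(2)] .
  then obtain D i where D: "D \<in> K'" "D i = seg f" using arcs_ofE by blast
  have "D (i + 1) = seg (nxt 0 f)" using curve_nxt[OF K'(1) D(1) conn_bwd.hyps(2) D(2)] .
  then have "nxt 0 f \<in> arcs_of K'" using arcs_ofI[OF K'(1) D(1)] conn_bwd.hyps(2) by simp
  then have "K = K'" using arcs_of_unique conn_bwd.prems(1) K'(1) nf by blast
  then show ?case using K' by simp
qed

definition curve_at :: "arc \<Rightarrow> curve" where
  "curve_at e = (THE K. K \<in> \<C> \<and> e \<in> arcs_of K)"

lemma curve_at: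
  assumes "is_arc e"
  shows "curve_at e \<in> \<C>" "e \<in> arcs_of (curve_at e)"
proof -
  have "\<exists>!K. K \<in> \<C> \<and> e \<in> arcs_of K"
    using arcs_of_exists[OF assms] arcs_of_unique by metis
  from theI'[OF this] have "curve_at e \<in> \<C> \<and> e \<in> arcs_of (curve_at e)"
    unfolding curve_at_def .
  then show "curve_at e \<in> \<C>" "e \<in> arcs_of (curve_at e)" by blast+
qed

text \<open>This reduces the count of curves to a count of classes of \<open>conn 0\<close>.\<close>

lemma curve_at_eq_iff:
  assumes "is_arc e" "is_arc f"
  shows "curve_at e = curve_at f \<longleftrightarrow> conn 0 e f"
  using curve_at[OF assms(1)] curve_at[OF assms(2)] arcs_of_conn conn_arcs_of arcs_of_unique by metis

lemma curve_is_curve_at: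
  assumes "K \<in> \<C>"
  obtains e where "is_arc e" "K = curve_at e"
proof -
  obtain C0 where "K = curve_of C0"
    using assms covering by (auto simp: folding_covering_def complete_folding_curves_def quotient_def curve_of_def)
  then have "C0 \<in> K" using curve_of_self by simp
  then obtain e where e: "is_arc e" "C0 0 = seg e" using curve_follows_nxt[OF assms] by metis
  then have "e \<in> arcs_of K" using arcs_ofI[OF assms \<open>C0 \<in> K\<close>] by blast
  then have "K = curve_at e" using curve_at[OF e(1)] arcs_of_unique assms by blast
  with e show ?thesis using that by blast
qed

lemma curve_walk:
  assumes "K \<in> \<C>" "D \<in> K"
  obtains w' where "\<And>h. is_arc (w' h)" "\<And>h. D (h + 1) = seg (w' h)" "\<And>h. w' (h + 1) = nxt 0 (w' h)"
proof -
  have "\<forall>h. \<exists>e. is_arc e \<and> D (h + 1) = seg e" using curve_follows_nxt[OF assms] by metis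
  then obtain w' where w': "\<And>h. is_arc (w' h) \<and> D (h + 1) = seg (w' h)" by metis
  have "w' (h + 1) = nxt 0 (w' h)" for h
  proof -
    have "seg (w' (h + 1)) = seg (nxt 0 (w' h))"
      using curve_nxt[OF assms, of "w' h" "h + 1"] w'[of h] w'[of "h + 1"] by simp
    then show ?thesis using seg_inject w' is_arc_nxt by blast
  qed
  with w' that show ?thesis by blast
qed

lemma turns_walk:
  assumes "\<And>h. is_arc (w' h)" "\<And>h. D (h + 1) = seg (w' h)" "\<And>h. w' (h + 1) = nxt 0 (w' h)"
  shows "turns D h = turn 0 (start (w' h))"
proof -
  have "turns D h = turn_sign (D h) (D (h + 1))" by (simp add: turns_def turn_sign_def)
  also have "\<dots> = turn_sign (seg (w' (h - 1))) (seg (step (turn 0 (head (w' (h - 1)))) (w' (h - 1))))"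
    using assms(2)[of "h - 1"] assms(2)[of h] assms(3)[of "h - 1"] by (simp add: nxt_def)
  also have "\<dots> = turn 0 (head (w' (h - 1)))" using turn_sign_step[OF assms(1) turn_cases] .
  also have "head (w' (h - 1)) = start (w' h)" using assms(3)[of "h - 1"] by simp
  finally show ?thesis .
qed

text \<open>A curve reading S starts at 0 by \<open>walk_start_0\<close>, and only two arcs leave 0.
  Conversely, one of them lies on C and the other on the reflection of C.\<close>

lemma has_assoc_seq_iff:
  assumes "K \<in> \<C>"
  shows "has_assoc_seq K s \<longleftrightarrow> K = curve_at (0, 0, 1) \<or> K = curve_at (0, 0, -1)"
proof
  assume "has_assoc_seq K s"
  then obtain D where D: "D \<in> K" "turns D = s" by (auto simp: has_assoc_seq_def)
  obtain w' where w': "\<And>h. is_arc (w' h)" "\<And>h. D (h + 1) = seg (w' h)" "\<And>h. w' (h + 1) = nxt 0 (w' h)"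
    using curve_walk[OF assms D(1)] by metis
  have t: "turn 0 (start (w' h)) = s h" for h using turns_walk[of w' D h, OF w'] D(2) by simp
  have "walk s w'" unfolding walk_def using w'(1,3) t by (metis nxt_def start_nxt)
  then have "start (w' 0) = (0, 0)" using walk_start_0[OF _ toeplitz_s t] by blast
  then have "w' 0 = (0, 0, 1) \<or> w' 0 = (0, 0, -1)" using w'(1)[of 0] by (cases "w' 0") auto
  moreover have "w' 0 \<in> arcs_of K" using arcs_ofI[OF assms D(1) w'(2) w'(1)] .
  then have "K = curve_at (w' 0)" using curve_at[OF w'(1)] arcs_of_unique assms by blast
  ultimately show "K = curve_at (0, 0, 1) \<or> K = curve_at (0, 0, -1)" by metis
next
  have arc: "is_arc (0, 0, 1)" "is_arc (0, 0, -1)" by auto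
  assume "K = curve_at (0, 0, 1) \<or> K = curve_at (0, 0, -1)"
  then show "has_assoc_seq K s"
  proof
    assume K: "K = curve_at (0, 0, 1)"
    have "C 1 = seg (0, 0, 1)" using C_eq_seg[of 1] w_0 by simp
    then have "(0, 0, 1) \<in> arcs_of (curve_of C)" using arcs_ofI[OF C_mem curve_of_self] arc by blast
    then have "K = curve_of C" using K curve_at[OF arc(1)] arcs_of_unique C_mem by blast
    then show ?thesis using turns_C curve_of_self by (auto simp: has_assoc_seq_def)
  next
    assume K: "K = curve_at (0, 0, -1)"
    then have "(0, 0, -1) \<in> arcs_of K" using curve_at[OF arc(2)] by simp
    then obtain D0 i where D0: "D0 \<in> K" "D0 i = seg (0, 0, -1)" using arcs_ofE[OF assms] by blast
    \<comment> \<open>Shifted so that \<open>D 1\<close> is the edge \<open>(0, 0, -1)\<close>,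
      matching \<open>C 1\<close> and \<open>w 0\<close>.\<close>
    define D where "D = (\<lambda>h. D0 (h + (i - 1)))"
    have "D \<in> K" using covering_curve(2)[OF covering assms D0(1)] by (auto simp: D_def curve_of_eq)
    obtain w' where w': "\<And>h. is_arc (w' h)" "\<And>h. D (h + 1) = seg (w' h)" "\<And>h. w' (h + 1) = nxt 0 (w' h)"
      using curve_walk[OF assms \<open>D \<in> K\<close>] by metis
    have "seg (w' 0) = seg (0, 0, -1)" using w'(2)[of 0] D0(2) by (simp add: D_def)
    then have w0: "w' 0 = (0, 0, -1)" using seg_inject[OF w'(1) arc(2)] by blast
    have neg: "w' h = neg_arc (w h)" for h
    proof (induction h rule: int_induct[of _ 0])
      case base
      then show ?case by (simp add: w0 w_0)
    next
      case (step1 h)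
      then show ?case using w'(3)[of h] w_nxt[of h] by (simp add: nxt_neg_arc)
    next
      case (step2 h)
      have "nxt 0 (w' (h - 1)) = nxt 0 (neg_arc (w (h - 1)))"
        using step2 w'(3)[of "h - 1"] w_nxt[of "h - 1"] by (simp add: nxt_neg_arc)
      then show ?case by (rule nxt_inject)
    qed
    have "turns D h = s h" for h
      using turns_walk[of w' D h, OF w'] walk_turn[OF walk_w toeplitz_s w_0, of h]
      by (simp add: neg start_neg_arc turn_minus)
    then have "turns D = s" by blast
    then show ?thesis using \<open>D \<in> K\<close> by (auto simp: has_assoc_seq_def)
  qed
qed

lemma card_center_curves: "card {curve_at (0, 0, 1), curve_at (0, 0, -1)} = 2"
  using curve_at_eq_iff[of "(0, 0, 1)" "(0, 0, -1)"] not_conn_center by simp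

lemma assoc_curves: "{K \<in> \<C>. has_assoc_seq K s} = {curve_at (0, 0, 1), curve_at (0, 0, -1)}"
  using has_assoc_seq_iff curve_at(1)[of "(0, 0, 1)"] curve_at(1)[of "(0, 0, -1)"] by auto

lemma alternating_count:
  assumes "\<And>m. m \<ge> N \<Longrightarrow> \<alpha> (Suc m) = - \<alpha> m"
  shows "card {K \<in> \<C>. has_assoc_seq K s} = 2 \<and> card {K \<in> \<C>. \<not> has_assoc_seq K s} = 4"
proof -
  obtain r where r: "\<And>i. i < 4 \<Longrightarrow> is_arc (r i)"
    "\<And>i. i < 4 \<Longrightarrow> \<not> conn 0 (r i) (0, 0, 1) \<and> \<not> conn 0 (r i) (0, 0, -1)"
    "\<And>i j. i < 4 \<Longrightarrow> j < (4::nat) \<Longrightarrow> conn 0 (r i) (r j) \<Longrightarrow> i = j"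
    "\<And>e. is_arc e \<Longrightarrow> conn 0 e (0, 0, 1) \<or> conn 0 e (0, 0, -1) \<or> (\<exists>i<4. conn 0 e (r i))"
    using alternating_representatives[of N, OF assms] by blast
  have arc: "is_arc (0, 0, 1)" "is_arc (0, 0, -1)" by auto
  have "{K \<in> \<C>. \<not> has_assoc_seq K s} = (\<lambda>i. curve_at (r i)) ` {..<4}"
  proof (intro equalityI subsetI)
    fix K assume "K \<in> {K \<in> \<C>. \<not> has_assoc_seq K s}"
    then have K: "K \<in> \<C>" "K \<noteq> curve_at (0, 0, 1)" "K \<noteq> curve_at (0, 0, -1)"
      using has_assoc_seq_iff by auto
    obtain e where e: "is_arc e" "K = curve_at e" using curve_is_curve_at[OF K(1)] .
    then obtain i where "i < 4" "conn 0 e (r i)"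
      using r(4)[OF e(1)] K curve_at_eq_iff[OF e(1) arc(1)] curve_at_eq_iff[OF e(1) arc(2)] by blast
    then show "K \<in> (\<lambda>i. curve_at (r i)) ` {..<4}" using e curve_at_eq_iff[OF e(1) r(1)] by blast
  next
    fix K assume "K \<in> (\<lambda>i. curve_at (r i)) ` {..<4}"
    then obtain i where i: "i < 4" "K = curve_at (r i)" by blast
    then show "K \<in> {K \<in> \<C>. \<not> has_assoc_seq K s}"
      using has_assoc_seq_iff curve_at[OF r(1)[OF i(1)]] r(2)[OF i(1)]
        curve_at_eq_iff[OF r(1)[OF i(1)] arc(1)] curve_at_eq_iff[OF r(1)[OF i(1)] arc(2)] by auto
  qed
  moreover have "inj_on (\<lambda>i. curve_at (r i)) {..<4}"
    using curve_at_eq_iff r(1,3) by (auto simp: inj_on_def)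
  ultimately show ?thesis by (simp add: card_image assoc_curves card_center_curves)
qed

lemma not_alternating_count:
  assumes "\<And>N. \<exists>m\<ge>N. \<alpha> m = \<alpha> (Suc m)"
  shows "card \<C> = 2 \<and> (\<forall>K\<in>\<C>. has_assoc_seq K s)"
proof -
  have assoc: "has_assoc_seq K s" if K: "K \<in> \<C>" for K
  proof -
    obtain e where e: "is_arc e" "K = curve_at e" using curve_is_curve_at[OF K] .
    have "is_arc (0, 0, 1)" "is_arc (0, 0, -1)" by auto
    with conn_center_if_not_alternating[OF assms e(1), of 0] show ?thesis
      using has_assoc_seq_iff[OF K] e curve_at_eq_iff[OF e(1)] by blast
  qed
  then have "\<C> = {K \<in> \<C>. has_assoc_seq K s}" by blast
  then have "card \<C> = 2" using assoc_curves card_center_curves by simp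
  with assoc show ?thesis by blast
qed

end

theorem theorem3p15:
  fixes a :: "nat \<Rightarrow> int" and \<epsilon> :: int and C :: "int \<Rightarrow> segment" and \<C> :: "curve set"
  assumes "infinite_folding_seq a"
    and "\<epsilon> \<in> {1, -1}"
    and "complete_curve C"
    and "turns C = two_sided a \<epsilon>"
    and "folding_covering \<C>"
    and "curve_of C \<in> \<C>"
    and "local_isomorphism \<C>"
  shows "(finite {n::nat. a (2 ^ n) = (-1) ^ n} \<or> finite (- {n::nat. a (2 ^ n) = (-1) ^ n}) \<longrightarrow>
            card {K \<in> \<C>. has_assoc_seq K (two_sided a \<epsilon>)} = 2 \<and>
            card {K \<in> \<C>. \<not> has_assoc_seq K (two_sided a \<epsilon>)} = 4) \<and>
         (\<not> (finite {n::nat. a (2 ^ n) = (-1) ^ n} \<or> finite (- {n::nat. a (2 ^ n) = (-1) ^ n})) \<longrightarrow>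
            card \<C> = 2 \<and> (\<forall>K\<in>\<C>. has_assoc_seq K (two_sided a \<epsilon>)))"
proof -
  have \<epsilon>: "\<epsilon> = 1 \<or> \<epsilon> = -1" using assms(2) by simp
  interpret folding_plane "\<lambda>n. a (2 ^ n)" \<epsilon> using toeplitz_two_sided(1)[OF assms(1) \<epsilon>] .
  \<comment> \<open>The frame is placed at the start of \<open>C 1\<close>, because the middle
    letter \<epsilon> is the turn from \<open>C 0\<close> to \<open>C 1\<close>.\<close>
  obtain ox oy ux uy where o: "fst (C 1) = (ox, oy)" and u: "dir (C 1) = (ux, uy)" by fastforce
  have "is_segment (C 1)" using assms(3) by (simp add: complete_curve_def)
  then have "\<bar>ux\<bar> + \<bar>uy\<bar> = 1" by (simp add: is_segment_def u)
  then have "(ux = 0 \<and> (uy = 1 \<or> uy = -1)) \<or> ((ux = 1 \<or> ux = -1) \<and> uy = 0)" by linarith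
  then have "ux * ux + uy * uy = 1" by auto
  then interpret frame ox oy ux uy by unfold_locales
  have seg1: "seg (0, 0, 1) = C 1"
    using o u by (cases "C 1") (auto simp: seg_def emb_def dir_def)
  obtain w where w: "\<And>h. is_arc (w h)" "\<And>h. seg (w h) = C (h + 1)" "w 0 = (0, 0, 1)"
    "\<And>h. w (h + 1) = step (turns C (h + 1)) (w h)"
    using curve_arcs[OF assms(3) _ seg1] by auto
  interpret covered_plane "\<lambda>n. a (2 ^ n)" \<epsilon> ox oy ux uy "two_sided a \<epsilon>" C w \<C>
    using toeplitz_two_sided(2)[OF assms(1) \<epsilon>] assms w by unfold_locales auto
  have pm: "a (2 ^ n) = 1 \<or> a (2 ^ n) = -1" for n by (rule \<alpha>)
  note iff = eventually_alternating_iff[of "\<lambda>n. a (2 ^ n)", OF pm]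
  show ?thesis
  proof (intro conjI impI)
    assume "finite {n. a (2 ^ n) = (-1) ^ n} \<or> finite (- {n. a (2 ^ n) = (-1) ^ n})"
    then obtain N where "\<And>m. m \<ge> N \<Longrightarrow> a (2 ^ Suc m) = - a (2 ^ m)" unfolding iff by blast
    from alternating_count[OF this]
    show "card {K \<in> \<C>. has_assoc_seq K (two_sided a \<epsilon>)} = 2"
      "card {K \<in> \<C>. \<not> has_assoc_seq K (two_sided a \<epsilon>)} = 4" by blast+
  next
    assume "\<not> (finite {n. a (2 ^ n) = (-1) ^ n} \<or> finite (- {n. a (2 ^ n) = (-1) ^ n}))"
    then have "\<exists>m\<ge>N. a (2 ^ m) = a (2 ^ Suc m)" for N
      unfolding iff using pm by (metis minus_minus)
    from not_alternating_count[OF this]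
    show "card \<C> = 2" "\<forall>K\<in>\<C>. has_assoc_seq K (two_sided a \<epsilon>)" by blast+
  qed
qed

end
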